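(* The class of discrete PMQ surfaces consists of discrete projective minimal and discrete Q surfaces.
   Context: Discrete asymptotic net: a $\mathbb Z^2$ lattice of points in $\mathbb P^3$, with homogeneous coordinates $\mathbf r:\mathbb Z^2\to\mathbb R^4$, such that every star (a vertex and its four neighbours) is planar. Subscripts $1,2$ denote unit increments of $n_1,n_2$. With respect to the frame $\mathbf r,\mathbf r_1,\mathbf r_2,\mathbf r_{12}$ (assumed linearly independent), one has $\mathbf r_{11}=\alpha^0\mathbf r+\alpha^1\mathbf r_1+\alpha^3\mathbf r_{12}$, $\mathbf r_{112}=\beta^1\mathbf r_1+\beta^2\mathbf r_2+\beta^3\mathbf r_{12}$, $\mathbf r_{22}=\gamma^0\mathbf r+\gamma^2\mathbf r_2+\gamma^3\mathbf r_{12}$, $\mathbf r_{122}=\delta^1\mathbf r_1+\delta^2\mathbf r_2+\delta^3\mathbf r_{12}$ (upper indices of the coefficients are labels; all coefficients are functions on $\mathbb Z^2$), where only $\alpha^1,\beta^3,\gamma^2,\delta^3$ are allowed to vanish. Lattice Lie quadrics: a quadric through the (extended) edges of the quadrilateral $[\mathbf r,\mathbf r_1,\mathbf r_2,\mathbf r_{12}]$ is $Q(s,t)=p\,\mathbf r_{12}+s\,\mathbf r_1+t\,\mathbf r_2+st\,\mathbf r$, where $p$ labels the quadric within the one-parameter family of such quadrics and $s,t$ parametrise its generators. A choice of such a quadric for every quadrilateral (neighbouring quadrics being denoted by $Q_1,Q_2$ etc.) is a set of lattice Lie quadrics if the $\mathcal C^1$ condition holds: the tangent planes of any two neighbouring quadrics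 coincide at each point of their common edge. A shared generator of two neighbouring quadrics is a line, transversal to their common edge, which is a generator of both. Envelope: a discrete envelope of a set of lattice Lie quadrics is a dual lattice $\Omega$ of $\mathbb Z^2$ combinatorics, with one vertex $\boldsymbol\omega\in Q$ for each quadric $Q$, such that each star of $\Omega$ touches the corresponding lattice Lie quadric (i.e. the edges of $\Omega$ emanating from $\boldsymbol\omega$ lie in the tangent plane of $Q$ at $\boldsymbol\omega$). Homogeneity convention: if a property related to the envelope holds for pairs of neighbouring quadrics then it is assumed to hold for all neighbouring quadrics of the same type. In particular, if two neighbouring quadrics have a (coinciding) shared generator which forms part of an envelope then all quadrics along that strip are assumed to have the same (coinciding) generator. Discrete PMQ surface: a discrete asymptotic net which admits a discrete envelope of an associated set of lattice Lie quadrics. Discrete Q surface: a discrete asymptotic net which admits an envelope $\Omega$ whose (extended) edges are shared generators of the associated lattice Lie quadrics, so that the coordinate polygons of $\Omega$ are straight lines. Discrete projective minimal surface: put $D^1=(\alpha^0\beta^3-\alpha^1\beta^2p)^2+4\alpha^0\alpha^3\beta^1\beta^2p$, $D^2=(\gamma^0\delta^3-\gamma^2\delta^1p)^2+4\gamma^0\gamma^3\delta^1\delta^2p$, $T^1=D^1/(\alpha^0\beta^2p)^2$, $T^2=D^2/(\gamma^0\delta^1p)^2$. A discrete asymptotic net (with its set of lattice Lie quadrics) is a discrete projective minimal surface if $T^1_2-T^1=0$ or, equivalently, $T^2_1-T^2=0$ in a gauge in which $(1-p^2)\frac{\beta^2\delta^1}{\beta^1\delta^2}=1$. Here, a change of gauge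 is a rescaling $\mathbf r\to x\mathbf r$ of the homogeneous coordinates by a scalar function $x$ on $\mathbb Z^2$, under which the coefficients change accordingly and $p\to\frac{x_1x_2}{x\,x_{12}}\,p$.
   Formalization: Envelope vertices must lie off the extended edges (else the net itself is always an envelope); coincidence of the two shared generators is assumed for all or no neighbouring quadrics in each lattice direction; gauge functions may be complex, as a real normalised gauge need not exist. *)

theory Defs
  imports "HOL-Analysis.Analysis"
begin

text \<open>
  Points, lines and planes of projective 3-space are linear subspaces of dimension 1, 2 and 3 of the
  space of homogeneous coordinates. The subscripts 1, 2, 12 are written as shifts of the lattice
  arguments: \<open>r (m + 1) n\<close>, \<open>r m (n + 1)\<close>, \<open>r (m + 1) (n + 1)\<close>.
\<close>

type_synonym 'k lattice = "int \<Rightarrow> int \<Rightarrow> 'k ^ 4"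

type_synonym 'k lattice_fun = "int \<Rightarrow> int \<Rightarrow> 'k"


subsection \<open>Discrete asymptotic nets\<close>

text \<open>The coefficients live over an arbitrary field because gauge functions will be complex.\<close>

record 'k coeffs =
  al0 :: "'k lattice_fun"  al1 :: "'k lattice_fun"  al3 :: "'k lattice_fun"
  be1 :: "'k lattice_fun"  be2 :: "'k lattice_fun"  be3 :: "'k lattice_fun"
  ga0 :: "'k lattice_fun"  ga2 :: "'k lattice_fun"  ga3 :: "'k lattice_fun"
  de1 :: "'k lattice_fun"  de2 :: "'k lattice_fun"  de3 :: "'k lattice_fun"

definition frame_equations :: "('k::field) lattice \<Rightarrow> 'k coeffs \<Rightarrow> bool" where
  "frame_equations r C \<longleftrightarrow> (\<forall>m n.
     r (m + 2) n = al0 C m n *s r m n + al1 C m n *s r (m + 1) n + al3 C m n *s r (m + 1) (n + 1) \<and>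
     r (m + 2) (n + 1) =
       be1 C m n *s r (m + 1) n + be2 C m n *s r m (n + 1) + be3 C m n *s r (m + 1) (n + 1) \<and>
     r m (n + 2) = ga0 C m n *s r m n + ga2 C m n *s r m (n + 1) + ga3 C m n *s r (m + 1) (n + 1) \<and>
     r (m + 1) (n + 2) =
       de1 C m n *s r (m + 1) n + de2 C m n *s r m (n + 1) + de3 C m n *s r (m + 1) (n + 1))"

definition regular_coeffs :: "('k::field) coeffs \<Rightarrow> bool" where
  "regular_coeffs C \<longleftrightarrow> (\<forall>m n.
     al0 C m n \<noteq> 0 \<and> al3 C m n \<noteq> 0 \<and> be1 C m n \<noteq> 0 \<and> be2 C m n \<noteq> 0 \<and>
     ga0 C m n \<noteq> 0 \<and> ga3 C m n \<noteq> 0 \<and> de1 C m n \<noteq> 0 \<and> de2 C m n \<noteq> 0)"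

definition planar_stars :: "real lattice \<Rightarrow> bool" where
  "planar_stars r \<longleftrightarrow> (\<forall>m n. \<exists>H. subspace H \<and> dim H = 3 \<and>
     {r m n, r (m + 1) n, r (m - 1) n, r m (n + 1), r m (n - 1)} \<subseteq> H)"

definition frames_independent :: "real lattice \<Rightarrow> bool" where
  "frames_independent r \<longleftrightarrow> (\<forall>m n.
     independent {r m n, r (m + 1) n, r m (n + 1), r (m + 1) (n + 1)} \<and>
     card {r m n, r (m + 1) n, r m (n + 1), r (m + 1) (n + 1)} = 4)"

text \<open>Planarity of the stars and independence of the frames make \<open>C\<close> exist and unique.\<close>

definition discrete_asymptotic_net :: "real lattice \<Rightarrow> bool" where
  "discrete_asymptotic_net r \<longleftrightarrow>
     planar_stars r \<and> frames_independent r \<and> (\<exists>C. frame_equations r C \<and> regular_coeffs C)"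


subsection \<open>Lattice Lie quadrics\<close>

text \<open>
  \<open>lie_point r p m n (1, s) (1, t)\<close> is the point \<open>Q(s,t)\<close>. Homogenising both parameters adds the
  generators \<open>s = \<infinity>\<close> and \<open>t = \<infinity>\<close>, which are the extended edges meeting at \<open>r\<close>.
\<close>

definition lie_point ::
  "real lattice \<Rightarrow> real lattice_fun \<Rightarrow> int \<Rightarrow> int \<Rightarrow> real \<times> real \<Rightarrow> real \<times> real \<Rightarrow> real ^ 4" where
  "lie_point r p m n = (\<lambda>(u, s) (v, t).
     (u * v * p m n) *\<^sub>R r (m + 1) (n + 1) + (s * v) *\<^sub>R r (m + 1) n
     + (u * t) *\<^sub>R r m (n + 1) + (s * t) *\<^sub>R r m n)"

definition lie_quadric ::
  "real lattice \<Rightarrow> real lattice_fun \<Rightarrow> int \<Rightarrow> int \<Rightarrow> (real ^ 4) set" where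
  "lie_quadric r p m n = {lie_point r p m n a b | a b. True}"

text \<open>
  \<open>lie_point\<close> is bilinear in its two parameters, so \<open>lie_point c b\<close> and \<open>lie_point a c\<close> are its
  partial derivatives at \<open>(a, b)\<close> in direction \<open>c\<close>; for \<open>X \<noteq> 0\<close> the parameters of \<open>X\<close> are unique up
  to scale.
\<close>

definition tangent_plane ::
  "real lattice \<Rightarrow> real lattice_fun \<Rightarrow> int \<Rightarrow> int \<Rightarrow> real ^ 4 \<Rightarrow> (real ^ 4) set" where
  "tangent_plane r p m n X = span {Y. \<exists>a b c. X = lie_point r p m n a b \<and>
     (Y = lie_point r p m n c b \<or> Y = lie_point r p m n a c)}"

definition generator ::
  "real lattice \<Rightarrow> real lattice_fun \<Rightarrow> int \<Rightarrow> int \<Rightarrow> (real ^ 4) set \<Rightarrow> bool" where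
  "generator r p m n L \<longleftrightarrow> subspace L \<and> dim L = 2 \<and> L \<subseteq> lie_quadric r p m n"

definition common_edge1 :: "real lattice \<Rightarrow> int \<Rightarrow> int \<Rightarrow> (real ^ 4) set" where
  "common_edge1 r m n = span {r (m + 1) n, r (m + 1) (n + 1)}"

definition common_edge2 :: "real lattice \<Rightarrow> int \<Rightarrow> int \<Rightarrow> (real ^ 4) set" where
  "common_edge2 r m n = span {r m (n + 1), r (m + 1) (n + 1)}"

definition lattice_Lie_quadrics :: "real lattice \<Rightarrow> real lattice_fun \<Rightarrow> bool" where
  "lattice_Lie_quadrics r p \<longleftrightarrow> (\<forall>m n. p m n \<noteq> 0) \<and>
     (\<forall>m n. \<forall>X \<in> common_edge1 r m n. X \<noteq> 0 \<longrightarrow>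
        tangent_plane r p m n X = tangent_plane r p (m + 1) n X) \<and>
     (\<forall>m n. \<forall>X \<in> common_edge2 r m n. X \<noteq> 0 \<longrightarrow>
        tangent_plane r p m n X = tangent_plane r p m (n + 1) X)"

text \<open>Transversality to the common edge: the two lines meet in exactly one point.\<close>

definition shared_generator1 ::
  "real lattice \<Rightarrow> real lattice_fun \<Rightarrow> int \<Rightarrow> int \<Rightarrow> (real ^ 4) set \<Rightarrow> bool" where
  "shared_generator1 r p m n L \<longleftrightarrow> generator r p m n L \<and> generator r p (m + 1) n L \<and>
     dim (L \<inter> common_edge1 r m n) = 1"

definition shared_generator2 ::
  "real lattice \<Rightarrow> real lattice_fun \<Rightarrow> int \<Rightarrow> int \<Rightarrow> (real ^ 4) set \<Rightarrow> bool" where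
  "shared_generator2 r p m n L \<longleftrightarrow> generator r p m n L \<and> generator r p m (n + 1) L \<and>
     dim (L \<inter> common_edge2 r m n) = 1"

text \<open>
  Two neighbouring quadrics have at most two shared generators (the roots of a quadratic with
  discriminant \<open>D1\<close> or \<open>D2\<close>); they coincide when there is exactly one. By the homogeneity convention this
  happens for all or for none of the pairs of neighbours in a given lattice direction.
\<close>

definition homogeneous_quadrics :: "real lattice \<Rightarrow> real lattice_fun \<Rightarrow> bool" where
  "homogeneous_quadrics r p \<longleftrightarrow>
     ((\<forall>m n. \<exists>!L. shared_generator1 r p m n L) \<or> (\<forall>m n. \<not> (\<exists>!L. shared_generator1 r p m n L))) \<and>
     ((\<forall>m n. \<exists>!L. shared_generator2 r p m n L) \<or> (\<forall>m n. \<not> (\<exists>!L. shared_generator2 r p m n L)))"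


subsection \<open>Envelopes\<close>

definition edge1 :: "real lattice \<Rightarrow> int \<Rightarrow> int \<Rightarrow> (real ^ 4) set" where
  "edge1 w m n = span {w m n, w (m + 1) n}"

definition edge2 :: "real lattice \<Rightarrow> int \<Rightarrow> int \<Rightarrow> (real ^ 4) set" where
  "edge2 w m n = span {w m n, w m (n + 1)}"

definition off_edges :: "real lattice \<Rightarrow> int \<Rightarrow> int \<Rightarrow> real ^ 4 \<Rightarrow> bool" where
  "off_edges r m n X \<longleftrightarrow>
     X \<notin> span {r m n, r (m + 1) n} \<and> X \<notin> span {r m n, r m (n + 1)} \<and>
     X \<notin> span {r (m + 1) n, r (m + 1) (n + 1)} \<and> X \<notin> span {r m (n + 1), r (m + 1) (n + 1)}"

text \<open>
  The condition \<open>off_edges\<close> excludes the trivial envelope: the stars of the net itself touch the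
  quadrics, so \<open>w = r\<close> would otherwise be an envelope of every net. The condition on \<open>dim\<close> says that
  neighbouring vertices are distinct points, that is, the edges are lines.
\<close>

definition discrete_envelope :: "real lattice \<Rightarrow> real lattice_fun \<Rightarrow> real lattice \<Rightarrow> bool" where
  "discrete_envelope r p w \<longleftrightarrow> (\<forall>m n.
     w m n \<in> lie_quadric r p m n \<and> off_edges r m n (w m n) \<and>
     dim (edge1 w m n) = 2 \<and> dim (edge2 w m n) = 2 \<and>
     edge1 w m n \<subseteq> tangent_plane r p m n (w m n) \<and>
     edge2 w m n \<subseteq> tangent_plane r p m n (w m n) \<and>
     edge1 w (m - 1) n \<subseteq> tangent_plane r p m n (w m n) \<and>
     edge2 w m (n - 1) \<subseteq> tangent_plane r p m n (w m n))"

text \<open>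
  Homogeneity convention for envelopes: in each lattice direction, all edges are shared generators
  of the corresponding neighbouring quadrics or none is.
\<close>

definition homogeneous_envelope :: "real lattice \<Rightarrow> real lattice_fun \<Rightarrow> real lattice \<Rightarrow> bool" where
  "homogeneous_envelope r p w \<longleftrightarrow>
     ((\<forall>m n. shared_generator1 r p m n (edge1 w m n)) \<or>
      (\<forall>m n. \<not> shared_generator1 r p m n (edge1 w m n))) \<and>
     ((\<forall>m n. shared_generator2 r p m n (edge2 w m n)) \<or>
      (\<forall>m n. \<not> shared_generator2 r p m n (edge2 w m n)))"

definition PMQ_wrt :: "real lattice \<Rightarrow> real lattice_fun \<Rightarrow> bool" where
  "PMQ_wrt r p \<longleftrightarrow> (\<exists>w. discrete_envelope r p w \<and> homogeneous_envelope r p w)"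

definition Q_wrt :: "real lattice \<Rightarrow> real lattice_fun \<Rightarrow> bool" where
  "Q_wrt r p \<longleftrightarrow> (\<exists>w. discrete_envelope r p w \<and>
     (\<forall>m n. shared_generator1 r p m n (edge1 w m n) \<and> shared_generator2 r p m n (edge2 w m n)))"


subsection \<open>Projective minimality\<close>

definition D1 :: "('k::field) coeffs \<Rightarrow> 'k lattice_fun \<Rightarrow> 'k lattice_fun" where
  "D1 C p m n = (al0 C m n * be3 C m n - al1 C m n * be2 C m n * p m n)\<^sup>2
     + 4 * al0 C m n * al3 C m n * be1 C m n * be2 C m n * p m n"

definition D2 :: "('k::field) coeffs \<Rightarrow> 'k lattice_fun \<Rightarrow> 'k lattice_fun" where
  "D2 C p m n = (ga0 C m n * de3 C m n - ga2 C m n * de1 C m n * p m n)\<^sup>2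
     + 4 * ga0 C m n * ga3 C m n * de1 C m n * de2 C m n * p m n"

definition T1 :: "('k::field) coeffs \<Rightarrow> 'k lattice_fun \<Rightarrow> 'k lattice_fun" where
  "T1 C p m n = D1 C p m n / (al0 C m n * be2 C m n * p m n)\<^sup>2"

definition T2 :: "('k::field) coeffs \<Rightarrow> 'k lattice_fun \<Rightarrow> 'k lattice_fun" where
  "T2 C p m n = D2 C p m n / (ga0 C m n * de1 C m n * p m n)\<^sup>2"

text \<open>
  Gauge functions are complex-valued: the normalisation prescribes the square of the new \<open>p\<close>, which
  may be a negative real number.
\<close>

definition gauge_net :: "complex lattice_fun \<Rightarrow> real lattice \<Rightarrow> complex lattice" where
  "gauge_net x r m n = x m n *s (\<chi> i. complex_of_real (r m n $ i))"

definition gauge_label :: "complex lattice_fun \<Rightarrow> real lattice_fun \<Rightarrow> complex lattice_fun" where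
  "gauge_label x p m n =
     x (m + 1) n * x m (n + 1) / (x m n * x (m + 1) (n + 1)) * complex_of_real (p m n)"

definition normalised_gauge :: "('k::field) coeffs \<Rightarrow> 'k lattice_fun \<Rightarrow> bool" where
  "normalised_gauge C p \<longleftrightarrow> (\<forall>m n.
     (1 - (p m n)\<^sup>2) * (be2 C m n * de1 C m n / (be1 C m n * de2 C m n)) = 1)"

definition projective_minimal_wrt :: "real lattice \<Rightarrow> real lattice_fun \<Rightarrow> bool" where
  "projective_minimal_wrt r p \<longleftrightarrow> (\<exists>x C. (\<forall>m n. x m n \<noteq> 0) \<and>
     frame_equations (gauge_net x r) C \<and> normalised_gauge C (gauge_label x p) \<and>
     ((\<forall>m n. T1 C (gauge_label x p) m (n + 1) - T1 C (gauge_label x p) m n = 0) \<or>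
      (\<forall>m n. T2 C (gauge_label x p) (m + 1) n - T2 C (gauge_label x p) m n = 0)))"


subsection \<open>The three classes of surfaces\<close>

definition net_with_quadrics :: "real lattice \<Rightarrow> real lattice_fun \<Rightarrow> bool" where
  "net_with_quadrics r p \<longleftrightarrow>
     discrete_asymptotic_net r \<and> lattice_Lie_quadrics r p \<and> homogeneous_quadrics r p"

definition discrete_PMQ_surface :: "real lattice \<Rightarrow> bool" where
  "discrete_PMQ_surface r \<longleftrightarrow> (\<exists>p. net_with_quadrics r p \<and> PMQ_wrt r p)"

definition discrete_Q_surface :: "real lattice \<Rightarrow> bool" where
  "discrete_Q_surface r \<longleftrightarrow> (\<exists>p. net_with_quadrics r p \<and> Q_wrt r p)"

definition discrete_projective_minimal_surface :: "real lattice \<Rightarrow> bool" where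
  "discrete_projective_minimal_surface r \<longleftrightarrow>
     (\<exists>p. net_with_quadrics r p \<and> projective_minimal_wrt r p)"

end

theory Submission
  imports Defs "HOL-Library.Quadratic_Discriminant"
begin

text \<open>
  A vertex of an envelope off the edges is \<open>Q(s,t)\<close> with \<open>s, t \<noteq> 0\<close>. Tangency along an edge of
  the first lattice direction, at both of its ends, amounts to a symmetric bilinear equation between
  \<open>s\<close> and \<open>p s\<^sub>1\<close> (the two parameters are conjugate with respect to the shared generators) together
  with the alternative that either \<open>p s\<^sub>1 = s\<close>, in which case the edge is itself a shared generator,
  or \<open>t\<^sub>1\<close> is the image of \<open>t\<close> under an explicit Moebius map; likewise with the directions exchanged.
  If the edges of one direction are not shared generators, then the Moebius maps carry the bilinear
  form of one quadrilateral to that of its neighbour up to a constant term, the obstruction, which has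
  to vanish. The obstruction is symmetric in the two directions, and in the distinguished gauge, where
  \<open>p\<^sup>2 = \<alpha>\<^sup>0\<^sub>2 / \<beta>\<^sup>2\<close>, it is a nonzero multiple of \<open>T\<^sup>1\<^sub>2 - T\<^sup>1\<close>. Conversely, if it vanishes, generic
  initial values for \<open>s\<close> and \<open>t\<close> propagate over the whole lattice to an envelope no edge of which is a
  shared generator.
\<close>

section \<open>Coefficients of a net with lattice Lie quadrics\<close>

text \<open>Unless an edge of the first direction is a shared generator, its tangency constrains
  \<open>s\<close> only through the bilinear form and \<open>t\<close> only through a Moebius map.
  So the systems for \<open>s\<close> and \<open>t\<close> decouple, and that for \<open>t\<close>
  is the system for \<open>s\<close> on the mirrored net. The discriminants enter through
  determinants: the bilinear form has determinant \<open>- p disc\<close>, and the obstruction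
  occurs in a single coefficient, so comparing determinants ties it linearly to the discriminants of
  two neighbouring quadrilaterals. The gauge condition reads \<open>p\<^sup>2 \<beta>\<^sup>2
  \<delta>\<^sup>1 = \<beta>\<^sup>2 \<delta>\<^sup>1 - \<beta>\<^sup>1 \<delta>\<^sup>2\<close>,
  whose right side is \<open>\<alpha>\<^sup>0\<^sub>2 \<delta>\<^sup>1\<close>. The obstacle in the
  converse is global: some map might meet a pole, zero or a fixed point at any of infinitely many
  places. These are countably many forbidden values, so the initial values are taken outside a
  countable set closed under all maps. Where \<open>disc\<close> vanishes, the form splits into
  factors and defines no map, which calls for a separate construction; homogeneity keeps the two
  cases from mixing.\<close>

definition swap_lattice :: "(int \<Rightarrow> int \<Rightarrow> 'a) \<Rightarrow> int \<Rightarrow> int \<Rightarrow> 'a" where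
  "swap_lattice f m n = f n m"

text \<open>
  Exchanging the two lattice directions exchanges \<open>r\<^sub>1\<close> and \<open>r\<^sub>2\<close> as well, hence the upper labels
  \<open>1\<close> and \<open>2\<close>: \<open>\<beta>\<^sup>1\<close> goes to \<open>\<delta>\<^sup>2\<close> and \<open>\<beta>\<^sup>2\<close> to \<open>\<delta>\<^sup>1\<close>.
\<close>

definition swap_coeffs :: "'k coeffs \<Rightarrow> 'k coeffs" where
  "swap_coeffs C = \<lparr>
     al0 = swap_lattice (ga0 C), al1 = swap_lattice (ga2 C), al3 = swap_lattice (ga3 C),
     be1 = swap_lattice (de2 C), be2 = swap_lattice (de1 C), be3 = swap_lattice (de3 C),
     ga0 = swap_lattice (al0 C), ga2 = swap_lattice (al1 C), ga3 = swap_lattice (al3 C),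
     de1 = swap_lattice (be2 C), de2 = swap_lattice (be1 C), de3 = swap_lattice (be3 C)\<rparr>"

lemma swap_lattice_swap_lattice [simp]: "swap_lattice (swap_lattice f) = f"
  by (simp add: swap_lattice_def fun_eq_iff)

lemma swap_coeffs_swap_coeffs [simp]: "swap_coeffs (swap_coeffs C) = C"
  by (simp add: swap_coeffs_def)

lemma swap_coeffs_sel:
  "al0 (swap_coeffs C) m n = ga0 C n m" "al1 (swap_coeffs C) m n = ga2 C n m"
  "al3 (swap_coeffs C) m n = ga3 C n m" "be1 (swap_coeffs C) m n = de2 C n m"
  "be2 (swap_coeffs C) m n = de1 C n m" "be3 (swap_coeffs C) m n = de3 C n m"
  "ga0 (swap_coeffs C) m n = al0 C n m" "ga2 (swap_coeffs C) m n = al1 C n m"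
  "ga3 (swap_coeffs C) m n = al3 C n m" "de1 (swap_coeffs C) m n = be2 C n m"
  "de2 (swap_coeffs C) m n = be1 C n m" "de3 (swap_coeffs C) m n = be3 C n m"
  by (simp_all add: swap_coeffs_def swap_lattice_def)

section \<open>Quantities attached to one quadrilateral\<close>

definition conj_coeff :: "real coeffs \<Rightarrow> real lattice_fun \<Rightarrow> real lattice_fun" where
  "conj_coeff C p m n = p (m + 1) n * be3 C m n - al1 C m n"

text \<open>This coefficient belongs to the map of \<open>s\<close> along the second direction,
  whereas \<open>conj_coeff\<close> belongs to the form for \<open>s\<close> along the first. The
  counterparts for \<open>t\<close> are obtained through \<open>swap_coeffs\<close>.\<close>

definition move_coeff :: "real coeffs \<Rightarrow> real lattice_fun \<Rightarrow> real lattice_fun" where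
  "move_coeff C p m n = ga2 C m n + p m (n + 1) * de3 C m n"

text \<open>This is \<open>D1\<close> with the factor \<open>(be2 * p)^2\<close> removed, which the
  relation \<open>al0_eq\<close> makes possible; see \<open>T1_disc\<close>.\<close>

definition disc :: "real coeffs \<Rightarrow> real lattice_fun \<Rightarrow> real lattice_fun" where
  "disc C p m n = (conj_coeff C p m n)\<^sup>2 + 4 * p (m + 1) n * al3 C m n * be1 C m n"

text \<open>
  In the parameters \<open>x\<close> on \<open>Q\<close> and \<open>p y\<close>, where \<open>y\<close> is a parameter on \<open>Q\<^sub>1\<close>, this is \<open>1/p\<close> times a
  symmetric bilinear form; the roots \<open>x\<close> of its diagonal \<open>x = p y\<close> are the shared generators of \<open>Q\<close>
  and \<open>Q\<^sub>1\<close>.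
\<close>

definition conj_form :: "real coeffs \<Rightarrow> real lattice_fun \<Rightarrow> int \<Rightarrow> int \<Rightarrow> real \<Rightarrow> real \<Rightarrow> real" where
  "conj_form C p m n x y = 2 * al3 C m n * x * y + conj_coeff C p m n * (x + p m n * y)
     - 2 * p m n * p (m + 1) n * be1 C m n"

text \<open>The Moebius map \<open>y = ga0 / x - move_coeff / 2\<close> without denominators, so
  that it can enter polynomial identities.\<close>

definition moves :: "real coeffs \<Rightarrow> real lattice_fun \<Rightarrow> int \<Rightarrow> int \<Rightarrow> real \<Rightarrow> real \<Rightarrow> bool" where
  "moves C p m n x y \<longleftrightarrow> 2 * x * y + move_coeff C p m n * x = 2 * ga0 C m n"

text \<open>The constant term mentioned at the beginning, up to a factor: see \<open>conj_form_moves\<close>.\<close>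

definition obstruction :: "real coeffs \<Rightarrow> real lattice_fun \<Rightarrow> real lattice_fun" where
  "obstruction C p m n =
     p m (n + 1) * move_coeff C p (m + 1) n * conj_coeff C p m n - p (m + 1) n * conj_coeff C p m (n + 1) * move_coeff C p m n
     + 4 * p (m + 1) n * p m (n + 1) * p (m + 1) (n + 1) *
       (de1 C (m + 1) n * al3 C m n - be1 C m (n + 1))"

text \<open>The purely algebraic content of a net with Lie quadrics. \<open>al0_eq\<close> and
  \<open>ga0_eq\<close> express the C1 condition; \<open>be1_eq\<close> to \<open>be3_eq\<close>
  compute \<open>r\<^sub>1\<^sub>1\<^sub>2\<close> by shifting \<open>r\<^sub>1\<^sub>1\<close>;
  \<open>de1_eq\<close> to \<open>de3_eq\<close> compute \<open>r\<^sub>1\<^sub>2\<^sub>2\<close> by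
  shifting \<open>r\<^sub>2\<^sub>2\<close>; the last three compare components of the two
  expressions for \<open>r\<^sub>1\<^sub>1\<^sub>2\<^sub>2\<close>.\<close>

locale Lie_coeffs =
  fixes C :: "real coeffs" and p :: "real lattice_fun"
  assumes regular: "regular_coeffs C"
    and label_nz: "p m n \<noteq> 0"
    and al0_eq: "al0 C m n = p m n * p (m + 1) n * be2 C m n"
    and ga0_eq: "ga0 C m n = p m n * p m (n + 1) * de1 C m n"
    and be1_eq: "be1 C m n = al3 C m (n + 1) * de1 C m n"
    and be2_eq: "be2 C m n = al0 C m (n + 1) + al3 C m (n + 1) * de2 C m n"
    and be3_eq: "be3 C m n = al1 C m (n + 1) + al3 C m (n + 1) * de3 C m n"
    and de1_eq: "de1 C m n = ga0 C (m + 1) n + ga3 C (m + 1) n * be1 C m n"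
    and de2_eq: "de2 C m n = ga3 C (m + 1) n * be2 C m n"
    and de3_eq: "de3 C m n = ga2 C (m + 1) n + ga3 C (m + 1) n * be3 C m n"
    and comp_r1: "be3 C m (n + 1) * de1 C m n = de1 C (m + 1) n * al1 C m n + de3 C (m + 1) n * be1 C m n"
    and comp_r2: "be2 C m (n + 1) * ga2 C m n + be3 C m (n + 1) * de2 C m n = de3 C (m + 1) n * be2 C m n"
    and comp_r12: "be1 C m (n + 1) + be2 C m (n + 1) * ga3 C m n + be3 C m (n + 1) * de3 C m n
       = de1 C (m + 1) n * al3 C m n + de2 C (m + 1) n + de3 C (m + 1) n * be3 C m n"
begin

lemma coeff_nz:
  "al0 C m n \<noteq> 0" "al3 C m n \<noteq> 0" "be1 C m n \<noteq> 0" "be2 C m n \<noteq> 0"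
  "ga0 C m n \<noteq> 0" "ga3 C m n \<noteq> 0" "de1 C m n \<noteq> 0" "de2 C m n \<noteq> 0"
  using regular by (auto simp: regular_coeffs_def)

lemma swap: "Lie_coeffs (swap_coeffs C) (swap_lattice p)"
proof (unfold_locales, unfold swap_coeffs_sel swap_lattice_def, goal_cases)
  case 1 show ?case using regular by (simp add: regular_coeffs_def swap_coeffs_sel)
next
  case (2 m n) show ?case by (rule label_nz)
next
  case (3 m n) show ?case by (rule ga0_eq)
next
  case (4 m n) show ?case by (rule al0_eq)
next
  case (5 m n) show ?case by (rule de2_eq)
next
  case (6 m n) show ?case by (rule de1_eq)
next
  case (7 m n) show ?case by (rule de3_eq)
next
  case (8 m n) show ?case by (rule be2_eq)
next
  case (9 m n) show ?case by (rule be1_eq)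
next
  case (10 m n) show ?case by (rule be3_eq)
next
  case (11 m n) show ?case using comp_r2[of n m] by simp
next
  case (12 m n) show ?case using comp_r1[of n m] by simp
next
  case (13 m n) show ?case using comp_r12[of n m] by simp
qed

text \<open>Both sides equal the determinant \<open>be2 * de1 - be1 * de2\<close>, the same quantity
  that governs the normalisation of the gauge.\<close>

lemma cross_ratio: "ga0 C (m + 1) n * be2 C m n = al0 C m (n + 1) * de1 C m n"
  using be1_eq[of m n] be2_eq[of m n] de1_eq[of m n] de2_eq[of m n] by algebra

text \<open>This identity and \<open>conj_coeff_up2\<close> say how the two linear terms of the
  bilinear form transform under the Moebius maps; they match the terms in \<open>y\<close> and
  \<open>x\<close>, respectively, in \<open>conj_form_moves\<close>.\<close>

lemma conj_coeff_up1:
  "p (m + 1) n * de1 C m n * (conj_coeff C p m (n + 1) - al3 C m (n + 1) * move_coeff C p (m + 1) n)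
    = - ga0 C (m + 1) n * conj_coeff C p m n"
  using be1_eq[of m n] be3_eq[of m n] de1_eq[of m n] de3_eq[of m n] comp_r1[of m n] ga0_eq[of "m+1" n]
  unfolding conj_coeff_def move_coeff_def by algebra

lemma be3_up:
  "p (m + 1) n * p m (n + 1) * p (m + 1) (n + 1) * be3 C m (n + 1)
    = p m (n + 1) * al1 C m n + p (m + 1) n * al3 C m (n + 1) * ga2 C m n"
proof -
  \<comment> \<open>Eliminating the shifted \<open>de3\<close> from \<open>comp_r1\<close> and
    \<open>comp_r2\<close> leaves the shifted \<open>be3\<close> times the determinant of
    \<open>cross_ratio\<close>, which is the nonzero factor multiplied in here.\<close>
  have "de1 C m n * al0 C m (n + 1) * (p (m + 1) n * p m (n + 1) * p (m + 1) (n + 1) * be3 C m (n + 1))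
    = de1 C m n * al0 C m (n + 1) * (p m (n + 1) * al1 C m n + p (m + 1) n * al3 C m (n + 1) * ga2 C m n)"
    using be1_eq[of m n] be2_eq[of m n] comp_r1[of m n] comp_r2[of m n] cross_ratio[of m n]
      ga0_eq[of "m+1" n] al0_eq[of m "n+1"] by algebra
  then show ?thesis using coeff_nz by simp
qed

lemma conj_coeff_up2:
  "p (m + 1) n * (p m (n + 1) * conj_coeff C p m (n + 1) - al3 C m (n + 1) * move_coeff C p m n)
    = - p m (n + 1) * conj_coeff C p m n"
  using be3_up[of m n] be3_eq[of m n] unfolding conj_coeff_def move_coeff_def by algebra

text \<open>This amounts to comparing determinants in \<open>conj_form_moves\<close>. A form
  \<open>conj_form\<close> has determinant \<open>- p disc\<close>, the substitution multiplies it
  by the determinants of the Moebius maps, and changing only the coefficient of \<open>x * y\<close>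
  changes it by a multiple of the constant term, hence of \<open>be1\<close>.\<close>

lemma obstruction_disc:
  "al3 C m (n + 1) * obstruction C p m n * (p (m + 1) n * be2 C m n)
    = - p m (n + 1) * ((p (m + 1) n)\<^sup>2 * be2 C m n * disc C p m (n + 1) - al0 C m (n + 1) * disc C p m n)"
proof -
  have "p (m + 1) n * de1 C m n * (al3 C m (n + 1) * obstruction C p m n * (p (m + 1) n * be2 C m n)) =
    p (m + 1) n * de1 C m n * (- p m (n + 1) * ((p (m + 1) n)\<^sup>2 * be2 C m n * disc C p m (n + 1) - al0 C m (n + 1) * disc C p m n))"
    using conj_coeff_up1[of m n] conj_coeff_up2[of m n] cross_ratio[of m n] ga0_eq[of "m+1" n] be1_eq[of m n]
    unfolding obstruction_def disc_def by algebra
  then show ?thesis using coeff_nz(7) label_nz by (metis mult_eq_0_iff mult_left_cancel)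
qed

text \<open>By \<open>comp_r12\<close> the last brackets of the two obstructions differ by
  \<open>\<beta>\<^sup>3\<^sub>2 \<delta>\<^sup>3 - \<delta>\<^sup>3\<^sub>1
  \<beta>\<^sup>3\<close>. With the shifted coefficients expressed by \<open>be3_up\<close> and its
  mirror image, this cancels against the quadratic terms.\<close>

lemma obstruction_swap: "obstruction (swap_coeffs C) (swap_lattice p) n m = obstruction C p m n"
proof -
  have be3_up': "p (m + 1) n * p m (n + 1) * p (m + 1) (n + 1) * de3 C (m + 1) n
    = p (m + 1) n * ga2 C m n + p m (n + 1) * ga3 C (m + 1) n * al1 C m n"
    using Lie_coeffs.be3_up[OF swap, of n m]
    by (simp add: swap_coeffs_sel swap_lattice_def algebra_simps)
  show ?thesis
    using be3_up[of m n] be3_up' be3_eq[of m n] de3_eq[of m n] comp_r12[of m n]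
    unfolding obstruction_def conj_coeff_def move_coeff_def swap_coeffs_sel swap_lattice_def by algebra
qed

text \<open>After inserting the Moebius maps and clearing denominators, the constant terms agree by
  \<open>be1_eq\<close> and \<open>ga0_eq\<close>, and the linear terms by the two transformation
  laws of \<open>conj_coeff\<close>. Only the coefficients of \<open>x * y\<close> may
  differ.\<close>

lemma conj_form_moves:
  assumes "moves C p m n x x'" "moves C p (m + 1) n y y'"
  shows "2 * p (m + 1) n * x * y * conj_form C p m (n + 1) x' y' =
     - 2 * p m (n + 1) * ga0 C (m + 1) n * conj_form C p m n x y + obstruction C p m n * x * y"
proof -
  have "p (m + 1) n * de1 C m n * (2 * p (m + 1) n * x * y * conj_form C p m (n + 1) x' y') =
     p (m + 1) n * de1 C m n * (
     - 2 * p m (n + 1) * ga0 C (m + 1) n * conj_form C p m n x y + obstruction C p m n * x * y)"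
    using assms conj_coeff_up1[of m n] conj_coeff_up2[of m n] ga0_eq[of "m+1" n] ga0_eq[of m n] be1_eq[of m n]
    unfolding obstruction_def conj_form_def moves_def by algebra
  then show ?thesis using coeff_nz(7) label_nz by (metis mult_eq_0_iff mult_left_cancel)
qed

end

section \<open>Propagating one parameter of the envelope\<close>

text \<open>Two runs of dependent choice start at 0, one upwards and one downwards. The conjunct
  \<open>k = 0 --> ...\<close> pins both to \<open>a\<close>, so that they can be glued.\<close>

lemma int_chain:
  fixes P :: "int \<Rightarrow> 'a \<Rightarrow> bool"
  assumes start: "P 0 a"
    and up: "\<And>m a. P m a \<Longrightarrow> \<exists>b. P (m + 1) b \<and> R m a b"
    and down: "\<And>m b. P (m + 1) b \<Longrightarrow> \<exists>a. P m a \<and> R m a b"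
  shows "\<exists>f. f 0 = a \<and> (\<forall>m. P m (f m) \<and> R m (f m) (f (m + 1)))"
proof -
  have "\<exists>b. (P (int (Suc k)) b \<and> (Suc k = 0 \<longrightarrow> b = a)) \<and> R (int k) c b"
    if "P (int k) c \<and> (k = 0 \<longrightarrow> c = a)" for c k
    using up[of "int k" c] that by (auto simp: add.commute)
  then obtain g where g: "\<And>k. P (int k) (g k) \<and> (k = 0 \<longrightarrow> g k = a)"
      "\<And>k. R (int k) (g k) (g (Suc k))"
    using dependent_nat_choice[of "\<lambda>k b. P (int k) b \<and> (k = 0 \<longrightarrow> b = a)" "\<lambda>k. R (int k)"] start
    by (metis of_nat_0)
  have "\<exists>b. (P (- int (Suc k)) b \<and> (Suc k = 0 \<longrightarrow> b = a)) \<and> R (- int (Suc k)) b c"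
    if "P (- int k) c \<and> (k = 0 \<longrightarrow> c = a)" for c k
    using down[of "- int (Suc k)" c] that by auto
  then obtain h where h: "\<And>k. P (- int k) (h k) \<and> (k = 0 \<longrightarrow> h k = a)"
      "\<And>k. R (- int (Suc k)) (h (Suc k)) (h k)"
    using dependent_nat_choice[of "\<lambda>k b. P (- int k) b \<and> (k = 0 \<longrightarrow> b = a)"
        "\<lambda>k c b. R (- int (Suc k)) b c"] start
    by (metis of_nat_0 neg_equal_zero)
  define f where "f m = (if m \<ge> 0 then g (nat m) else h (nat (- m)))" for m
  have "P m (f m) \<and> R m (f m) (f (m + 1))" for m
  proof (cases "m \<ge> 0")
    case True
    then show ?thesis using g(1)[of "nat m"] g(2)[of "nat m"] by (simp add: f_def nat_add_distrib)
  next
    case False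
    define k where "k = nat (- m - 1)"
    have k: "m = - int (Suc k)" using False by (simp add: k_def)
    have fk: "f (m + 1) = h k"
    proof (cases "k = 0")
      case True
      then show ?thesis using g(1)[of 0] h(1)[of 0] by (simp add: f_def k)
    next
      case False
      then have "\<not> m + 1 \<ge> 0" "nat (- (m + 1)) = k" by (auto simp: k)
      then show ?thesis by (simp only: f_def if_False)
    qed
    have "f m = h (Suc k)" by (simp only: f_def k) (simp add: nat_add_distrib)
    then show ?thesis using h(1)[of "Suc k"] h(2)[of k] fk k by simp
  qed
  then show ?thesis using g(1)[of 0] by (intro exI[of _ f]) (simp add: f_def)
qed

text \<open>All finite words in \<open>F\<close> are applied to the elements of \<open>G\<close>;
  there are only countably many such words.\<close>

lemma countable_closure:
  assumes "countable F" "countable G"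
  obtains B where "countable B" "G \<subseteq> B" "\<And>f x. f \<in> F \<Longrightarrow> x \<in> B \<Longrightarrow> f x \<in> B"
proof
  let ?B = "(\<lambda>(fs, x). foldr (\<lambda>f. f) fs x) ` (lists F \<times> G)"
  show "countable ?B" using assms by (intro countable_image countable_SIGMA countable_lists)
  show "G \<subseteq> ?B" by (force intro: image_eqI[where x = "([], x)" for x])
  show "f x \<in> ?B" if f: "f \<in> F" and x: "x \<in> ?B" for f x
  proof -
    obtain fs y where fy: "fs \<in> lists F" "y \<in> G" "x = foldr (\<lambda>f. f) fs y" using x by auto
    have "(f # fs, y) \<in> lists F \<times> G" using f fy by simp
    then show ?thesis using fy by (force intro: image_eqI[where x = "(f # fs, y)"])
  qed
qed

lemma countable_quadratic_roots:
  fixes a b c :: real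
  assumes "a \<noteq> 0"
  shows "countable {x. a * x\<^sup>2 + b * x + c = 0}"
proof (rule countable_subset)
  show "{x. a * x\<^sup>2 + b * x + c = 0}
      \<subseteq> {(- b + sqrt (discrim a b c)) / (2 * a), (- b - sqrt (discrim a b c)) / (2 * a)}"
    using discriminant_iff[OF assms] by blast
qed simp

lemma ex1_quadratic_root_iff:
  fixes a b c :: real
  assumes "a \<noteq> 0"
  shows "(\<exists>!x. a * x\<^sup>2 + b * x + c = 0) \<longleftrightarrow> discrim a b c = 0"
proof
  assume ex1: "\<exists>!x. a * x\<^sup>2 + b * x + c = 0"
  then obtain x where x: "a * x\<^sup>2 + b * x + c = 0" by blast
  \<comment> \<open>By Vieta, \<open>- b / a - x\<close> is the other root, so uniqueness makes
    \<open>x\<close> a double root.\<close>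
  have "a * (- b / a - x)\<^sup>2 + b * (- b / a - x) + c = a * x\<^sup>2 + b * x + c"
    using assms by (simp add: power2_eq_square field_simps)
  with ex1 x have "- b / a - x = x" by metis
  then have b: "b = - 2 * a * x" using assms by (simp add: field_simps)
  show "discrim a b c = 0" using x unfolding discrim_def b by algebra
next
  assume "discrim a b c = 0"
  then show "\<exists>!x. a * x\<^sup>2 + b * x + c = 0"
    using discriminant_zero[OF assms] by metis
qed

lemma int_eq_all_of_step:
  fixes P :: "int \<Rightarrow> bool"
  assumes "\<And>n. P n \<longleftrightarrow> P (n + 1)"
  shows "P n \<longleftrightarrow> P 0"
proof (induction n rule: int_induct[where k = 0])
  case (step1 i) then show ?case using assms[of i] by blast
next
  case (step2 i) then show ?case using assms[of "i - 1"] by (metis diff_add_cancel)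
qed simp

section \<open>Columns: one parameter along the second lattice direction\<close>

context Lie_coeffs
begin

definition column :: "int \<Rightarrow> (int \<Rightarrow> real) \<Rightarrow> bool" where
  "column m c \<longleftrightarrow> (\<forall>n. c n \<noteq> 0 \<and> moves C p m n (c n) (c (n + 1)))"

lemma moves_inj:
  assumes "moves C p m n x y" "moves C p m n x' y'" "x \<noteq> 0" "x' \<noteq> 0"
  shows "x = x' \<longleftrightarrow> y = y'"
proof
  assume "x = x'"
  then have "x * y = x * y'" using assms(1,2) by (simp only: moves_def mult.assoc)
  then show "y = y'" using assms by simp
next
  assume y: "y = y'"
  have e: "x * (2 * y + move_coeff C p m n) = 2 * ga0 C m n" "x' * (2 * y + move_coeff C p m n) = 2 * ga0 C m n"
    using assms y by (simp_all add: moves_def algebra_simps)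
  then have "2 * y + move_coeff C p m n \<noteq> 0" using coeff_nz(5)[of m n] by auto
  then show "x = x'" using e by (metis mult_right_cancel)
qed

text \<open>In the degenerate case this reduces comparison with the distinguished columns to the row
  \<open>n = 0\<close>.\<close>

lemma column_eq:
  assumes "column m c" "column m d"
  shows "c n = d n \<longleftrightarrow> c 0 = d 0"
  by (rule int_eq_all_of_step) (use assms moves_inj in \<open>unfold column_def, blast\<close>)

text \<open>Thus conjugacy of neighbouring columns has to be arranged in the row
  \<open>n = 0\<close> only, and the problem on the lattice becomes a chain of columns.\<close>

lemma column_conj_form:
  assumes "column m c" "column (m + 1) d" "\<And>n. obstruction C p m n = 0"
  shows "conj_form C p m n (c n) (d n) = 0 \<longleftrightarrow> conj_form C p m 0 (c 0) (d 0) = 0"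
proof (rule int_eq_all_of_step)
  fix n
  show "conj_form C p m n (c n) (d n) = 0 \<longleftrightarrow> conj_form C p m (n + 1) (c (n + 1)) (d (n + 1)) = 0"
    using conj_form_moves[of m n "c n" "c (n + 1)" "d n" "d (n + 1)"] assms coeff_nz(5) label_nz
    by (auto simp: column_def)
qed

text \<open>
  The complement of such a set is stable under all Moebius maps in question (unless the bilinear form
  degenerates), and they have neither poles nor fixed points there.
\<close>

definition generic :: "real set \<Rightarrow> bool" where
  "generic B \<longleftrightarrow> 0 \<in> B \<and> (\<forall>m n.
     - (conj_coeff C p m n * p m n) / (2 * al3 C m n) \<in> B \<and> - conj_coeff C p m n / (2 * al3 C m n) \<in> B \<and>
     - move_coeff C p m n / 2 \<in> B \<and>
     (\<forall>x. conj_form C p m n x (x / p m n) = 0 \<longrightarrow> x \<in> B) \<and>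
     (\<forall>x\<in>B. ga0 C m n / x - move_coeff C p m n / 2 \<in> B \<and> ga0 C m n / (x + move_coeff C p m n / 2) \<in> B \<and>
       (2 * p m n * p (m + 1) n * be1 C m n - conj_coeff C p m n * x) / (2 * al3 C m n * x + conj_coeff C p m n * p m n) \<in> B \<and>
       (2 * p m n * p (m + 1) n * be1 C m n - conj_coeff C p m n * p m n * x) / (2 * al3 C m n * x + conj_coeff C p m n) \<in> B))"

lemma genericD:
  assumes "generic B"
  shows "0 \<in> B" "- (conj_coeff C p m n * p m n) / (2 * al3 C m n) \<in> B" "- conj_coeff C p m n / (2 * al3 C m n) \<in> B"
    "- move_coeff C p m n / 2 \<in> B"
    "conj_form C p m n x (x / p m n) = 0 \<Longrightarrow> x \<in> B"
    "x \<in> B \<Longrightarrow> ga0 C m n / x - move_coeff C p m n / 2 \<in> B"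
    "x \<in> B \<Longrightarrow> ga0 C m n / (x + move_coeff C p m n / 2) \<in> B"
    "x \<in> B \<Longrightarrow> (2 * p m n * p (m + 1) n * be1 C m n - conj_coeff C p m n * x)
       / (2 * al3 C m n * x + conj_coeff C p m n * p m n) \<in> B"
    "x \<in> B \<Longrightarrow> (2 * p m n * p (m + 1) n * be1 C m n - conj_coeff C p m n * p m n * x)
       / (2 * al3 C m n * x + conj_coeff C p m n) \<in> B"
  using assms unfolding generic_def by blast+

lemma generic_exists: obtains B where "countable B" "generic B"
proof -
  let ?F1 = "\<lambda>m n x. ga0 C m n / x - move_coeff C p m n / 2"
  let ?F2 = "\<lambda>m n x. ga0 C m n / (x + move_coeff C p m n / 2)"
  let ?F3 = "\<lambda>m n x. (2 * p m n * p (m + 1) n * be1 C m n - conj_coeff C p m n * x) / (2 * al3 C m n * x + conj_coeff C p m n * p m n)"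
  let ?F4 = "\<lambda>m n x. (2 * p m n * p (m + 1) n * be1 C m n - conj_coeff C p m n * p m n * x) / (2 * al3 C m n * x + conj_coeff C p m n)"
  let ?F = "\<Union>m n. {?F1 m n, ?F2 m n, ?F3 m n, ?F4 m n}"
  let ?G = "{0} \<union> (\<Union>m n. {- (conj_coeff C p m n * p m n) / (2 * al3 C m n), - conj_coeff C p m n / (2 * al3 C m n),
     - move_coeff C p m n / 2} \<union> {x. conj_form C p m n x (x / p m n) = 0})"
  have "countable {x. conj_form C p m n x (x / p m n) = 0}" for m n
  proof -
    have "conj_form C p m n x (x / p m n) =
       (2 * al3 C m n / p m n) * x\<^sup>2 + 2 * conj_coeff C p m n * x + - (2 * p m n * p (m + 1) n * be1 C m n)" for x
      using label_nz[of m n] by (simp add: conj_form_def field_simps power2_eq_square)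
    then show ?thesis
      using countable_quadratic_roots[of "2 * al3 C m n / p m n" "2 * conj_coeff C p m n"
          "- (2 * p m n * p (m + 1) n * be1 C m n)"] coeff_nz(2)[of m n] label_nz[of m n]
      by (simp only: divide_eq_0_iff mult_eq_0_iff) simp
  qed
  then have G: "countable ?G" by auto
  have F: "countable ?F" by auto
  obtain B where B: "countable B" "?G \<subseteq> B" "\<And>f x. f \<in> ?F \<Longrightarrow> x \<in> B \<Longrightarrow> f x \<in> B"
    using countable_closure[OF F G] by blast
  have "?F1 m n x \<in> B" "?F2 m n x \<in> B" "?F3 m n x \<in> B" "?F4 m n x \<in> B" if "x \<in> B" for m n x
    using B(3)[of "?F1 m n" x] B(3)[of "?F2 m n" x] B(3)[of "?F3 m n" x] B(3)[of "?F4 m n" x] that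
    by blast+
  moreover have "0 \<in> B" "- (conj_coeff C p m n * p m n) / (2 * al3 C m n) \<in> B" "- conj_coeff C p m n / (2 * al3 C m n) \<in> B"
    "- move_coeff C p m n / 2 \<in> B" "conj_form C p m n x (x / p m n) = 0 \<Longrightarrow> x \<in> B" for m n x
    by (rule subsetD[OF B(2)], blast)+
  ultimately have "generic B" unfolding generic_def by (intro conjI allI ballI impI)
  with B(1) show ?thesis by (rule that)
qed

text \<open>The closure of \<open>B\<close> is used contrapositively: if the image of a point lay in
  \<open>B\<close>, the inverse map, which also preserves \<open>B\<close>, would bring the point
  itself into \<open>B\<close>.\<close>

lemma generic_column:
  assumes "generic B" "v \<notin> B"
  obtains c where "column m c" "c 0 = v" "\<And>n. c n \<notin> B"
proof -
  have B0: "x \<noteq> 0" if "x \<notin> B" for x using assms(1) that by (auto simp: generic_def)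
  have up: "\<exists>y. y \<notin> B \<and> moves C p m n x y" if "x \<notin> B" for n x
  proof -
    let ?y = "ga0 C m n / x - move_coeff C p m n / 2"
    have "ga0 C m n / (?y + move_coeff C p m n / 2) = x" using coeff_nz(5)[of m n] by simp
    then have "?y \<notin> B" using genericD(7)[OF assms(1), of ?y m n] that by auto
    moreover have "moves C p m n x ?y" using B0[OF that] by (simp add: moves_def field_simps)
    ultimately show ?thesis by blast
  qed
  have down: "\<exists>x. x \<notin> B \<and> moves C p m n x y" if "y \<notin> B" for n y
  proof -
    let ?x = "ga0 C m n / (y + move_coeff C p m n / 2)"
    have "- move_coeff C p m n / 2 \<in> B" by (rule genericD(4)[OF assms(1)])
    then have y: "y + move_coeff C p m n / 2 \<noteq> 0"
      using that by (metis add_eq_0_iff2 minus_divide_left)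
    have "ga0 C m n / ?x - move_coeff C p m n / 2 = y" using coeff_nz(5)[of m n] by simp
    then have "?x \<notin> B" using genericD(6)[OF assms(1), of ?x m n] that by auto
    moreover have "moves C p m n ?x y"
    proof -
      have "2 * x * y + move_coeff C p m n * x = 2 * (x * (y + move_coeff C p m n / 2))" for x
        by (simp add: algebra_simps)
      then show ?thesis using y by (simp only: moves_def times_divide_eq_left) simp
    qed
    ultimately show ?thesis by blast
  qed
  have "\<exists>c. c 0 = v \<and> (\<forall>n. c n \<notin> B \<and> moves C p m n (c n) (c (n + 1)))"
    by (rule int_chain) (fact assms(2) up down)+
  then obtain c where "c 0 = v" "\<And>n. c n \<notin> B" "\<And>n. moves C p m n (c n) (c (n + 1))"
    by blast
  then show ?thesis using that[of c] B0 by (auto simp: column_def)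
qed

lemma exists_not_in_countable: "countable B \<Longrightarrow> \<exists>v::real. v \<notin> B"
  using uncountable_UNIV_real by (metis UNIV_eq_I)

text \<open>The form is nondegenerate, so in the row \<open>n = 0\<close> it can be solved for
  either argument by a Moebius map that keeps the complement of \<open>B\<close>. Vanishing of the
  obstruction transports conjugacy to all rows.\<close>

lemma columns_of_disc_nz:
  assumes "\<And>m n. obstruction C p m n = 0" "\<And>m n. disc C p m n \<noteq> 0"
  shows "\<exists>s. \<forall>m. column m (s m) \<and> (\<forall>n. conj_form C p m n (s m n) (s (m + 1) n) = 0
           \<and> p m n * s (m + 1) n \<noteq> s m n)"
proof -
  obtain B where B: "countable B" "generic B" using generic_exists by blast
  obtain v where v: "v \<notin> B" using exists_not_in_countable[OF B(1)] by blast
  let ?P = "\<lambda>m c. column m c \<and> (\<forall>n. c n \<notin> B)"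
  let ?R = "\<lambda>m c d. conj_form C p m 0 (c 0) (d 0) = 0"
  have "x * (2 * al3 C m 0 * y + conj_coeff C p m 0) = 2 * p m 0 * p (m + 1) 0 * be1 C m 0 - conj_coeff C p m 0 * p m 0 * y
     \<longleftrightarrow> conj_form C p m 0 x y = 0"
    "y * (2 * al3 C m 0 * x + conj_coeff C p m 0 * p m 0) = 2 * p m 0 * p (m + 1) 0 * be1 C m 0 - conj_coeff C p m 0 * x
     \<longleftrightarrow> conj_form C p m 0 x y = 0" for m x y
    by (auto simp: conj_form_def algebra_simps)
  note cf = this
  have nz: "x = y" if "2 * al3 C m n * x + k = 0" "y = - k / (2 * al3 C m n)" for m n x y k
  proof -
    have "x * (2 * al3 C m n) = y * (2 * al3 C m n)" using that coeff_nz(2)[of m n] by (simp add: algebra_simps)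
    then show ?thesis using coeff_nz(2)[of m n] by simp
  qed
  \<comment> \<open>If the denominator vanishes at a point that has a conjugate, the numerator
    vanishes too, and then so does the determinant \<open>- p disc\<close>. This protects the map
    back, whose argument is not yet known to avoid \<open>B\<close>.\<close>
  have d: "False" if "2 * al3 C m 0 * x + conj_coeff C p m 0 * p m 0 = 0" "conj_form C p m 0 x y = 0" for m x y
  proof -
    have "p m 0 * disc C p m 0 = 0" using that unfolding conj_form_def disc_def by algebra
    then show False using assms(2) label_nz by simp
  qed
  have d': "False" if "2 * al3 C m 0 * y + conj_coeff C p m 0 = 0" "conj_form C p m 0 x y = 0" for m x y
  proof -
    have "p m 0 * disc C p m 0 = 0" using that unfolding conj_form_def disc_def by algebra
    then show False using assms(2) label_nz by simp
  qed
  have right: "\<exists>d. ?P (m + 1) d \<and> ?R m c d" if "?P m c" for m c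
  proof -
    define x y where "x = c 0" and "y = (2 * p m 0 * p (m + 1) 0 * be1 C m 0 - conj_coeff C p m 0 * x)
      / (2 * al3 C m 0 * x + conj_coeff C p m 0 * p m 0)"
    have "2 * al3 C m 0 * x + conj_coeff C p m 0 * p m 0 \<noteq> 0"
      using nz[of m 0 x "conj_coeff C p m 0 * p m 0", OF _ refl] genericD(2)[OF B(2), of m 0] that
      unfolding x_def by metis
    then have "y * (2 * al3 C m 0 * x + conj_coeff C p m 0 * p m 0)
        = 2 * p m 0 * p (m + 1) 0 * be1 C m 0 - conj_coeff C p m 0 * x" by (simp add: y_def)
    then have j: "conj_form C p m 0 x y = 0" using cf(2) by blast
    have "2 * al3 C m 0 * y + conj_coeff C p m 0 \<noteq> 0" using d'[OF _ j] by blast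
    then have "(2 * p m 0 * p (m + 1) 0 * be1 C m 0 - conj_coeff C p m 0 * p m 0 * y)
        / (2 * al3 C m 0 * y + conj_coeff C p m 0) = x"
      using cf(1)[of x m y] j by (metis nonzero_mult_div_cancel_right)
    then have "y \<notin> B" using genericD(9)[OF B(2), of y m 0] that x_def by metis
    then obtain d where "column (m + 1) d" "d 0 = y" "\<And>n. d n \<notin> B"
      using generic_column[OF B(2)] by blast
    then show ?thesis using j x_def by metis
  qed
  have left: "\<exists>c. ?P m c \<and> ?R m c d" if "?P (m + 1) d" for m d
  proof -
    define y x where "y = d 0" and "x = (2 * p m 0 * p (m + 1) 0 * be1 C m 0 - conj_coeff C p m 0 * p m 0 * y)
      / (2 * al3 C m 0 * y + conj_coeff C p m 0)"
    have "2 * al3 C m 0 * y + conj_coeff C p m 0 \<noteq> 0"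
      using nz[of m 0 y "conj_coeff C p m 0", OF _ refl] genericD(3)[OF B(2), of m 0] that
      unfolding y_def by metis
    then have "x * (2 * al3 C m 0 * y + conj_coeff C p m 0)
        = 2 * p m 0 * p (m + 1) 0 * be1 C m 0 - conj_coeff C p m 0 * p m 0 * y" by (simp add: x_def)
    then have j: "conj_form C p m 0 x y = 0" using cf(1) by blast
    have "2 * al3 C m 0 * x + conj_coeff C p m 0 * p m 0 \<noteq> 0" using d[OF _ j] by blast
    then have "(2 * p m 0 * p (m + 1) 0 * be1 C m 0 - conj_coeff C p m 0 * x)
        / (2 * al3 C m 0 * x + conj_coeff C p m 0 * p m 0) = y"
      using cf(2)[of y m x] j by (metis nonzero_mult_div_cancel_right)
    then have "x \<notin> B" using genericD(8)[OF B(2), of x m 0] that y_def by metis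
    then obtain c where "column m c" "c 0 = x" "\<And>n. c n \<notin> B"
      using generic_column[OF B(2)] by blast
    then show ?thesis using j y_def by metis
  qed
  obtain c0 where c0: "?P 0 c0" using generic_column[OF B(2) v] by metis
  have "\<exists>s. s 0 = c0 \<and> (\<forall>m. ?P m (s m) \<and> ?R m (s m) (s (m + 1)))"
    by (rule int_chain) (fact c0 right left)+
  then obtain s where s: "\<And>m. column m (s m)" "\<And>m n. s m n \<notin> B"
      "\<And>m. conj_form C p m 0 (s m 0) (s (m + 1) 0) = 0" by metis
  show ?thesis
  proof (intro exI[of _ s] allI conjI)
    fix m n
    show "column m (s m)" by (rule s(1))
    show j: "conj_form C p m n (s m n) (s (m + 1) n) = 0"
      using column_conj_form[OF s(1) s(1) assms(1)] s(3) by blast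
    \<comment> \<open>Equality would make \<open>s m n\<close> the parameter of a shared generator,
      and \<open>B\<close> contains all of these.\<close>
    show "p m n * s (m + 1) n \<noteq> s m n"
    proof
      assume "p m n * s (m + 1) n = s m n"
      then have "s (m + 1) n = s m n / p m n" using label_nz[of m n] by (simp add: field_simps)
      then have "s m n \<in> B" using j genericD(5)[OF B(2)] by simp
      then show False using s(2) by blast
    qed
  qed
qed

text \<open>
  Here the bilinear form degenerates to a multiple of \<open>(x - e) (y - f)\<close>, where \<open>e = p f\<close> is the
  coinciding shared generator. Consecutive columns are chosen such that exactly one of \<open>x = e\<close> and
  \<open>y = f\<close> holds: this makes the form vanish and keeps the edges from being shared generators.
\<close>

lemma columns_of_disc_zero:
  assumes disc0: "\<And>m n. disc C p m n = 0"
  shows "\<exists>s. \<forall>m. column m (s m) \<and> (\<forall>n. conj_form C p m n (s m n) (s (m + 1) n) = 0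
           \<and> p m n * s (m + 1) n \<noteq> s m n)"
proof -
  obtain B where B: "countable B" "generic B" using generic_exists by blast
  obtain v where v: "v \<notin> B" using exists_not_in_countable[OF B(1)] by blast
  define e where "e m n = - (conj_coeff C p m n * p m n) / (2 * al3 C m n)" for m n
  define f where "f m n = - conj_coeff C p m n / (2 * al3 C m n)" for m n
  have hc2: "(conj_coeff C p m n)\<^sup>2 = - 4 * p (m + 1) n * al3 C m n * be1 C m n" for m n
    using disc0[of m n] by (simp add: disc_def)
  \<comment> \<open>With a vanishing discriminant the square of \<open>conj_coeff\<close> is a
    product of nonzero factors. Hence \<open>e\<close> and \<open>f\<close> avoid zero, as columns
    must.\<close>
  have conj_coeff_nz: "conj_coeff C p m n \<noteq> 0" for m n
    using hc2[of m n] label_nz coeff_nz by (metis mult_eq_0_iff power_zero_numeral zero_neq_neg_numeral)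
  have ef: "e m n = p m n * f m n" for m n by (simp add: e_def f_def)
  have fe: "2 * al3 C m n * f m n = - conj_coeff C p m n" for m n using coeff_nz by (simp add: f_def)
  have f_nz: "f m n \<noteq> 0" for m n using conj_coeff_nz coeff_nz by (simp add: f_def)
  \<comment> \<open>Vanishing of \<open>disc\<close> everywhere forces the obstruction to vanish, so
    the Moebius maps carry the split form to the next split form and its factors to factors. This
    makes \<open>e\<close> a column, and likewise \<open>f\<close>.\<close>
  have "moves C p m n (e m n) (e m (n + 1))" for m n
  proof -
    have "p (m + 1) n * al3 C m (n + 1) * al3 C m n * (2 * e m n * e m (n + 1) + move_coeff C p m n * e m n)
      = p (m + 1) n * al3 C m (n + 1) * al3 C m n * (2 * ga0 C m n)"
      using conj_coeff_up2[of m n] hc2[of m n] be1_eq[of m n] ga0_eq[of m n] fe[of m n] fe[of m "n+1"]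
      unfolding ef by algebra
    then show ?thesis using coeff_nz(2) label_nz unfolding moves_def by (metis mult_eq_0_iff mult_left_cancel)
  qed
  then have e_col: "column m (e m)" for m using f_nz label_nz by (simp add: column_def ef)
  have "moves C p (m + 1) n (f m n) (f m (n + 1))" for m n
  proof -
    have "de1 C m n * p (m + 1) n * al3 C m (n + 1) * al3 C m n * (2 * f m n * f m (n + 1) + move_coeff C p (m + 1) n * f m n)
      = de1 C m n * p (m + 1) n * al3 C m (n + 1) * al3 C m n * (2 * ga0 C (m + 1) n)"
      using conj_coeff_up1[of m n] hc2[of m n] be1_eq[of m n] ga0_eq[of "m+1" n] fe[of m n] fe[of m "n+1"]
      by algebra
    then show ?thesis using coeff_nz(2,7) label_nz unfolding moves_def by (metis mult_eq_0_iff mult_left_cancel)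
  qed
  then have f_col: "column (m + 1) (f m)" for m using f_nz by (simp add: column_def)
  have cf: "conj_form C p m n x y = 2 * al3 C m n * (x - e m n) * (y - f m n)" for m n x y
  proof -
    have "al3 C m n * conj_form C p m n x y = al3 C m n * (2 * al3 C m n * (x - e m n) * (y - f m n))"
      using hc2[of m n] fe[of m n] unfolding ef conj_form_def by algebra
    then show ?thesis using coeff_nz(2) by (metis mult_left_cancel)
  qed
  have eB: "e m n \<in> B" and fB: "f m n \<in> B" for m n using genericD(2,3)[OF B(2)] by (simp_all add: e_def f_def)
  let ?R = "\<lambda>m c d. \<forall>n. conj_form C p m n (c n) (d n) = 0 \<and> p m n * d n \<noteq> c n"
  have right: "\<exists>d. column (m + 1) d \<and> ?R m c d" if c: "column m c" for m c
  proof (cases "c 0 = e m 0")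
    case True
    then have "c n = e m n" for n using column_eq[OF c e_col] by blast
    moreover obtain d where d: "column (m + 1) d" "\<And>n. d n \<notin> B" using generic_column[OF B(2) v] by metis
    moreover have "d n \<noteq> f m n" for n using d fB by metis
    ultimately show ?thesis using label_nz by (intro exI[of _ d]) (auto simp: cf ef)
  next
    case False
    then have "e m n \<noteq> c n" for n using column_eq[OF c e_col] by metis
    then show ?thesis using f_col[of m] by (intro exI[of _ "f m"]) (auto simp: cf ef)
  qed
  have left: "\<exists>c. column m c \<and> ?R m c d" if d: "column (m + 1) d" for m d
  proof (cases "d 0 = f m 0")
    case True
    then have "d n = f m n" for n using column_eq[OF d f_col] by blast
    moreover obtain c where c: "column m c" "\<And>n. c n \<notin> B" using generic_column[OF B(2) v] by metis
    moreover have "e m n \<noteq> c n" for n using c eB by metis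
    ultimately show ?thesis by (intro exI[of _ c]) (auto simp: cf ef)
  next
    case False
    then have "d n \<noteq> f m n" for n using column_eq[OF d f_col] by blast
    then show ?thesis using e_col[of m] label_nz by (intro exI[of _ "e m"]) (auto simp: cf ef)
  qed
  have "\<exists>s. s 0 = e 0 \<and> (\<forall>m. column m (s m) \<and> ?R m (s m) (s (m + 1)))"
    by (rule int_chain) (fact e_col right left)+
  then show ?thesis by blast
qed

end

section \<open>Frames, quadrics and rulings\<close>

lemma mem_span_pair: "z \<in> span {x, y} \<longleftrightarrow> (\<exists>a b. z = a *\<^sub>R x + b *\<^sub>R y)"
  by (simp add: span_breakdown_eq span_singleton image_iff diff_eq_eq add.commute)

lemma dim_span_pair:
  fixes x y :: "'a::euclidean_space"
  assumes "x \<noteq> 0" "\<And>k. y \<noteq> k *\<^sub>R x"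
  shows "dim (span {x, y}) = 2"
proof -
  have "y \<notin> span {x}" using assms(2) by (auto simp: span_singleton)
  then have "independent {y, x}" using assms(1) by (simp add: independent_insert)
  moreover have "y \<noteq> x" using assms(2)[of 1] by simp
  ultimately show ?thesis by (simp add: dim_eq_card_independent insert_commute)
qed

text \<open>The coordinates are ordered as the terms of \<open>Q(s,t)\<close>, which is therefore
  the point with coordinates \<open>p, s, t, s * t\<close>.\<close>

definition frame_point ::
  "real lattice \<Rightarrow> int \<Rightarrow> int \<Rightarrow> real \<Rightarrow> real \<Rightarrow> real \<Rightarrow> real \<Rightarrow> real ^ 4" where
  "frame_point r m n a b c d = a *\<^sub>R r (m + 1) (n + 1) + b *\<^sub>R r (m + 1) n + c *\<^sub>R r m (n + 1) + d *\<^sub>R r m n"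

lemma frame_point_add:
  "frame_point r m n a b c d + frame_point r m n a' b' c' d'
    = frame_point r m n (a + a') (b + b') (c + c') (d + d')"
  by (simp add: frame_point_def scaleR_add_left)

lemma frame_point_scale:
  "k *\<^sub>R frame_point r m n a b c d = frame_point r m n (k * a) (k * b) (k * c) (k * d)"
  by (simp add: frame_point_def scaleR_add_right)

lemma frame_point_0: "frame_point r m n 0 0 0 0 = 0"
  by (simp add: frame_point_def)

lemma lie_point_eq_frame_point:
  "lie_point r p m n a b = frame_point r m n
     (fst a * fst b * p m n) (snd a * fst b) (fst a * snd b) (snd a * snd b)"
  by (simp add: lie_point_def frame_point_def split: prod.splits)

lemma sum_four_zero:
  fixes x y z w :: "'a::real_vector"
  assumes "independent {x, y, z, w}" "card {x, y, z, w} = 4"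
    and "a *\<^sub>R x + b *\<^sub>R y + c *\<^sub>R z + d *\<^sub>R w = 0"
  shows "a = 0" "b = 0" "c = 0" "d = 0"
proof -
  have ne: "x \<noteq> y" "x \<noteq> z" "x \<noteq> w" "y \<noteq> z" "y \<noteq> w" "z \<noteq> w"
    using assms(2) by (auto simp: card_insert_if split: if_splits)
  define u where "u v = (if v = x then a else if v = y then b else if v = z then c else d)" for v
  have "(\<Sum>v\<in>{x, y, z, w}. u v *\<^sub>R v) = 0" using assms(3) ne by (simp add: u_def add.assoc)
  then have *: "v \<in> {x, y, z, w} \<Longrightarrow> u v = 0" for v
    using independentD[OF assms(1), of "{x, y, z, w}" u v] by blast
  show "a = 0" "b = 0" "c = 0" "d = 0"
    using *[of x] *[of y] *[of z] *[of w] ne by (simp_all add: u_def)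
qed

locale labelled_frames =
  fixes r :: "real lattice" and p :: "real lattice_fun"
  assumes frames: "frames_independent r" and label_nonzero: "p m n \<noteq> 0"
begin

lemma frame_point_eq_0_iff: "frame_point r m n a b c d = 0 \<longleftrightarrow> a = 0 \<and> b = 0 \<and> c = 0 \<and> d = 0"
proof
  assume "frame_point r m n a b c d = 0"
  then have "d *\<^sub>R r m n + b *\<^sub>R r (m + 1) n + c *\<^sub>R r m (n + 1) + a *\<^sub>R r (m + 1) (n + 1) = 0"
    by (simp add: frame_point_def algebra_simps)
  from sum_four_zero[OF _ _ this] frames
  show "a = 0 \<and> b = 0 \<and> c = 0 \<and> d = 0" unfolding frames_independent_def by blast
qed (simp add: frame_point_0)

lemma frame_point_eq_iff:
  "frame_point r m n a b c d = frame_point r m n a' b' c' d' \<longleftrightarrow> a = a' \<and> b = b' \<and> c = c' \<and> d = d'"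
proof -
  have "frame_point r m n a b c d - frame_point r m n a' b' c' d'
      = frame_point r m n (a - a') (b - b') (c - c') (d - d')"
    by (simp add: frame_point_def scaleR_diff_left)
  then show ?thesis using frame_point_eq_0_iff[of m n "a - a'" "b - b'" "c - c'" "d - d'"] by auto
qed

lemma mem_edge_iff:
  "frame_point r m n a b c d \<in> span {r m n, r (m + 1) n} \<longleftrightarrow> a = 0 \<and> c = 0"
  "frame_point r m n a b c d \<in> span {r m n, r m (n + 1)} \<longleftrightarrow> a = 0 \<and> b = 0"
  "frame_point r m n a b c d \<in> span {r (m + 1) n, r (m + 1) (n + 1)} \<longleftrightarrow> c = 0 \<and> d = 0"
  "frame_point r m n a b c d \<in> span {r m (n + 1), r (m + 1) (n + 1)} \<longleftrightarrow> b = 0 \<and> d = 0"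
proof -
  have "x *\<^sub>R r m n + y *\<^sub>R r (m + 1) n = frame_point r m n 0 y 0 x"
    "x *\<^sub>R r m n + z *\<^sub>R r m (n + 1) = frame_point r m n 0 0 z x"
    "y *\<^sub>R r (m + 1) n + w *\<^sub>R r (m + 1) (n + 1) = frame_point r m n w y 0 0"
    "z *\<^sub>R r m (n + 1) + w *\<^sub>R r (m + 1) (n + 1) = frame_point r m n w 0 z 0" for x y z w
    by (simp_all add: frame_point_def add.commute)
  then show
    "frame_point r m n a b c d \<in> span {r m n, r (m + 1) n} \<longleftrightarrow> a = 0 \<and> c = 0"
    "frame_point r m n a b c d \<in> span {r m n, r m (n + 1)} \<longleftrightarrow> a = 0 \<and> b = 0"
    "frame_point r m n a b c d \<in> span {r (m + 1) n, r (m + 1) (n + 1)} \<longleftrightarrow> c = 0 \<and> d = 0"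
    "frame_point r m n a b c d \<in> span {r m (n + 1), r (m + 1) (n + 1)} \<longleftrightarrow> b = 0 \<and> d = 0"
    by (simp_all only: mem_span_pair frame_point_eq_iff) auto
qed

section \<open>Equation, tangent planes and generators of a quadric\<close>

lemma frame_point_in_quadric_iff:
  "frame_point r m n a b c d \<in> lie_quadric r p m n \<longleftrightarrow> a * d = p m n * b * c"
proof
  assume "frame_point r m n a b c d \<in> lie_quadric r p m n"
  then show "a * d = p m n * b * c"
    by (auto simp: lie_quadric_def lie_point_eq_frame_point frame_point_eq_iff)
next
  assume eq: "a * d = p m n * b * c"
  have "\<exists>x y. frame_point r m n a b c d = lie_point r p m n x y"
  proof (cases "a = 0")
    case False
    then have "frame_point r m n a b c d = lie_point r p m n (1, b * p m n / a) (a / p m n, c)"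
      using eq label_nonzero[of m n] by (simp add: lie_point_eq_frame_point frame_point_eq_iff field_simps)
    then show ?thesis by blast
  next
    case True
    then consider "b = 0" | "c = 0" using eq label_nonzero[of m n] by auto
    then show ?thesis
    proof cases
      case 1
      with True have "frame_point r m n a b c d = lie_point r p m n (c, d) (0, 1)"
        by (simp add: lie_point_eq_frame_point)
      then show ?thesis by blast
    next
      case 2
      with True have "frame_point r m n a b c d = lie_point r p m n (0, 1) (b, d)"
        by (simp add: lie_point_eq_frame_point)
      then show ?thesis by blast
    qed
  qed
  then show "frame_point r m n a b c d \<in> lie_quadric r p m n" by (auto simp: lie_quadric_def)
qed

text \<open>The factor \<open>k\<close> stands on opposite sides in the two conclusions because the
  parameters scale inversely to each other; this avoids a reciprocal.\<close>

lemma lie_point_unique: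
  assumes "lie_point r p m n a b = lie_point r p m n a' b'" "lie_point r p m n a b \<noteq> 0"
  obtains k where "a' = k *\<^sub>R a" "b = k *\<^sub>R b'"
proof -
  obtain u s v t u' s' v' t' where ab: "a = (u, s)" "b = (v, t)" "a' = (u', s')" "b' = (v', t')"
    by (metis surj_pair)
  have eqs: "u * v = u' * v'" "s * v = s' * v'" "u * t = u' * t'" "s * t = s' * t'"
    using assms(1) label_nonzero[of m n] by (auto simp: ab lie_point_eq_frame_point frame_point_eq_iff)
  have nz: "(u \<noteq> 0 \<or> s \<noteq> 0)" "(v \<noteq> 0 \<or> t \<noteq> 0)"
    using assms(2) by (auto simp: ab lie_point_eq_frame_point frame_point_0)
  have nz': "(v' \<noteq> 0 \<or> t' \<noteq> 0)" using nz eqs by auto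
  have "\<exists>k. u' = k * u \<and> s' = k * s \<and> v = k * v' \<and> t = k * t'"
  proof (cases "u = 0")
    case False
    have "v = u' / u * v'" "t = u' / u * t'" using eqs False by (simp_all add: field_simps)
    moreover have "u' = u' / u * u" using False by simp
    moreover have "s' = u' / u * s"
    proof -
      have "v' * (s' * u) = v' * (u' * s)" "t' * (s' * u) = t' * (u' * s)" using eqs by algebra+
      then have "s' * u = u' * s" using nz' by auto
      then show ?thesis using False by (simp add: field_simps)
    qed
    ultimately show ?thesis by blast
  next
    case True
    then have s: "s \<noteq> 0" using nz by simp
    have "u' = 0" using True eqs nz' by auto
    then show ?thesis using True s eqs by (intro exI[of _ "s' / s"]) (simp add: field_simps)
  qed
  then show ?thesis using that by (auto simp: ab)
qed

lemma lie_point_scale: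
  "lie_point r p m n (k *\<^sub>R a) b = k *\<^sub>R lie_point r p m n a b"
  "lie_point r p m n a (k *\<^sub>R b) = k *\<^sub>R lie_point r p m n a b"
  by (simp_all add: lie_point_eq_frame_point frame_point_scale mult_ac)

lemma lie_point_add:
  "lie_point r p m n (a + a') b = lie_point r p m n a b + lie_point r p m n a' b"
  "lie_point r p m n a (b + b') = lie_point r p m n a b + lie_point r p m n a b'"
  by (simp_all add: lie_point_eq_frame_point frame_point_add algebra_simps)

text \<open>The definition ranges over all parameters of the point. By
  \<open>lie_point_unique\<close> they are multiples of one pair, so the two partial derivatives at
  that pair suffice.\<close>

lemma tangent_plane_eq:
  assumes "lie_point r p m n a b \<noteq> 0"
  shows "tangent_plane r p m n (lie_point r p m n a b)
    = {lie_point r p m n c b + lie_point r p m n a d | c d. True}" (is "_ = ?T")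
proof -
  have sub: "subspace ?T"
    unfolding subspace_def
  proof (intro conjI allI ballI)
    have "lie_point r p m n 0 b + lie_point r p m n a 0 = 0"
      by (simp add: lie_point_eq_frame_point frame_point_0)
    then have "\<exists>c d. 0 = lie_point r p m n c b + lie_point r p m n a d \<and> True" by metis
    then show "0 \<in> ?T" by simp
  next
    fix x y assume "x \<in> ?T" "y \<in> ?T"
    then obtain c d c' d' where "x = lie_point r p m n c b + lie_point r p m n a d"
      "y = lie_point r p m n c' b + lie_point r p m n a d'" by blast
    then have "x + y = lie_point r p m n (c + c') b + lie_point r p m n a (d + d')"
      by (simp add: lie_point_add)
    then show "x + y \<in> ?T" by blast
  next
    fix k x assume "x \<in> ?T"
    then obtain c d where "x = lie_point r p m n c b + lie_point r p m n a d" by blast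
    then have "k *\<^sub>R x = lie_point r p m n (k *\<^sub>R c) b + lie_point r p m n a (k *\<^sub>R d)"
      by (simp add: lie_point_scale scaleR_add_right)
    then show "k *\<^sub>R x \<in> ?T" by blast
  qed
  have z: "lie_point r p m n c 0 = 0" "lie_point r p m n 0 c = 0" for c
    by (simp_all add: lie_point_eq_frame_point frame_point_0)
  show ?thesis unfolding tangent_plane_def
  proof (rule span_unique)
    show "{Y. \<exists>a' b' c. lie_point r p m n a b = lie_point r p m n a' b' \<and>
        (Y = lie_point r p m n c b' \<or> Y = lie_point r p m n a' c)} \<subseteq> ?T"
    proof clarify
      fix Y a' b' c
      assume eq: "lie_point r p m n a b = lie_point r p m n a' b'"
        and Y: "Y = lie_point r p m n c b' \<or> Y = lie_point r p m n a' c"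
      obtain k where "a' = k *\<^sub>R a" using lie_point_unique[OF eq assms] .
      then have 1: "lie_point r p m n a' c = lie_point r p m n 0 b + lie_point r p m n a (k *\<^sub>R c)"
        by (simp add: z lie_point_scale)
      obtain k' where "b' = k' *\<^sub>R b" using lie_point_unique[OF eq[symmetric]] assms eq by metis
      then have 2: "lie_point r p m n c b' = lie_point r p m n (k' *\<^sub>R c) b + lie_point r p m n a 0"
        by (simp add: z lie_point_scale)
      show "\<exists>c d. Y = lie_point r p m n c b + lie_point r p m n a d \<and> True"
        using Y 1 2 by metis
    qed
    show "subspace ?T" by (rule sub)
    fix S' assume S: "{Y. \<exists>a' b' c. lie_point r p m n a b = lie_point r p m n a' b' \<and>
        (Y = lie_point r p m n c b' \<or> Y = lie_point r p m n a' c)} \<subseteq> S'" "subspace S'"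
    show "?T \<subseteq> S'"
    proof clarify
      fix c d
      have "lie_point r p m n c b \<in> S'" "lie_point r p m n a d \<in> S'" using S(1) by blast+
      then show "lie_point r p m n c b + lie_point r p m n a d \<in> S'" using S(2) by (rule subspace_add[rotated])
    qed
  qed
qed

text \<open>The equation is the polar form of \<open>a * d = p * b * c\<close> with respect to the
  point \<open>(p, s, t, s * t)\<close>.\<close>

lemma mem_tangent_plane_iff:
  assumes "k \<noteq> 0"
  shows "frame_point r m n a b c d \<in> tangent_plane r p m n (k *\<^sub>R lie_point r p m n (1, s) (1, t))
    \<longleftrightarrow> p m n * d + a * s * t = p m n * (s * c + t * b)"
proof -
  have k: "k *\<^sub>R lie_point r p m n (1, s) (1, t) = lie_point r p m n (k, k * s) (1, t)"
    using lie_point_scale(1)[of m n k "(1, s)" "(1, t)"] by simp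
  have nz: "lie_point r p m n (k, k * s) (1, t) \<noteq> 0"
    using assms label_nonzero by (simp add: lie_point_eq_frame_point frame_point_eq_0_iff)
  have "frame_point r m n a b c d \<in> tangent_plane r p m n (k *\<^sub>R lie_point r p m n (1, s) (1, t))
    \<longleftrightarrow> (\<exists>c1 c2 d1 d2. a = c1 * p m n + k * d1 * p m n \<and> b = c2 + k * s * d1 \<and>
          c = c1 * t + k * d2 \<and> d = c2 * t + k * s * d2)"
    unfolding k tangent_plane_eq[OF nz]
    by (simp add: lie_point_eq_frame_point frame_point_add frame_point_eq_iff)
  also have "\<dots> \<longleftrightarrow> p m n * d + a * s * t = p m n * (s * c + t * b)"
  proof
    assume "\<exists>c1 c2 d1 d2. a = c1 * p m n + k * d1 * p m n \<and> b = c2 + k * s * d1 \<and>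
          c = c1 * t + k * d2 \<and> d = c2 * t + k * s * d2"
    then show "p m n * d + a * s * t = p m n * (s * c + t * b)" by (auto simp: algebra_simps)
  next
    assume eq: "p m n * d + a * s * t = p m n * (s * c + t * b)"
    have "p m n * d = p m n * ((b - s * (a / p m n)) * t + s * c)"
    proof -
      have "a = p m n * (a / p m n)" using label_nonzero[of m n] by simp
      then show ?thesis using eq by algebra
    qed
    then have d: "d = (b - s * (a / p m n)) * t + s * c" using label_nonzero[of m n] by simp
    \<comment> \<open>The two generators through the point share the point itself, so one of the
      four unknowns is free: \<open>c1 = 0\<close>. The others are read off from the coordinates
      \<open>a\<close>, \<open>b\<close> and \<open>c\<close>.\<close>
    show "\<exists>c1 c2 d1 d2. a = c1 * p m n + k * d1 * p m n \<and> b = c2 + k * s * d1 \<and>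
          c = c1 * t + k * d2 \<and> d = c2 * t + k * s * d2"
      by (rule exI[of _ 0], rule exI[of _ "b - s * (a / p m n)"], rule exI[of _ "a / p m n / k"],
          rule exI[of _ "c / k"]) (use d assms label_nonzero[of m n] in simp)
  qed
  finally show ?thesis .
qed

text \<open>The four extended edges are the generators on which one of the homogeneous parameters
  \<open>u\<close>, \<open>v\<close>, \<open>s\<close>, \<open>t\<close> vanishes.\<close>

lemma off_edge_point:
  assumes "X \<in> lie_quadric r p m n" "off_edges r m n X"
  obtains k s t where "k \<noteq> 0" "s \<noteq> 0" "t \<noteq> 0" "X = k *\<^sub>R lie_point r p m n (1, s) (1, t)"
proof -
  obtain u s v t where X: "X = lie_point r p m n (u, s) (v, t)"
    using assms(1) by (auto simp: lie_quadric_def)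
  have nz: "u \<noteq> 0" "v \<noteq> 0" "s \<noteq> 0" "t \<noteq> 0"
    using assms(2) unfolding off_edges_def X lie_point_eq_frame_point mem_edge_iff by auto
  then have "X = (u * v) *\<^sub>R lie_point r p m n (1, s / u) (1, t / v)"
    by (simp add: X lie_point_eq_frame_point frame_point_scale mult.commute)
  then show ?thesis using that[of "u * v" "s / u" "t / v"] nz by simp
qed

lemma off_edges_lie_point:
  "s \<noteq> 0 \<Longrightarrow> t \<noteq> 0 \<Longrightarrow> off_edges r m n (lie_point r p m n (1, s) (1, t))"
  unfolding off_edges_def lie_point_eq_frame_point mem_edge_iff using label_nonzero by simp

text \<open>The generators of constant \<open>s\<close> are the family transversal to the common
  edge with \<open>Q\<^sub>1\<close>. The value \<open>s = \<infinity>\<close>, an extended edge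
  through \<open>r\<close>, is left out.\<close>

definition ruling :: "int \<Rightarrow> int \<Rightarrow> real \<Rightarrow> (real ^ 4) set" where
  "ruling m n s = range (lie_point r p m n (1, s))"

lemma mem_ruling_iff:
  "frame_point r m n a b c d \<in> ruling m n s \<longleftrightarrow> p m n * b = s * a \<and> d = s * c"
proof
  assume "p m n * b = s * a \<and> d = s * c"
  then have "frame_point r m n a b c d = lie_point r p m n (1, s) (a / p m n, c)"
    using label_nonzero[of m n] by (simp add: lie_point_eq_frame_point frame_point_eq_iff field_simps)
  then show "frame_point r m n a b c d \<in> ruling m n s" by (simp add: ruling_def)
qed (auto simp: ruling_def lie_point_eq_frame_point frame_point_eq_iff)

lemma ruling_eq_span: "ruling m n s = span {frame_point r m n (p m n) s 0 0, frame_point r m n 0 0 1 s}"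
proof (rule set_eqI)
  fix X
  have "X \<in> ruling m n s \<longleftrightarrow> (\<exists>v t. X = lie_point r p m n (1, s) (v, t))"
    by (auto simp: ruling_def)
  also have "\<dots> \<longleftrightarrow> X \<in> span {frame_point r m n (p m n) s 0 0, frame_point r m n 0 0 1 s}"
    by (simp add: mem_span_pair lie_point_eq_frame_point frame_point_scale frame_point_add mult.commute)
  finally show "X \<in> ruling m n s \<longleftrightarrow> X \<in> span {frame_point r m n (p m n) s 0 0, frame_point r m n 0 0 1 s}" .
qed

lemma generator_ruling: "generator r p m n (ruling m n s)"
  unfolding generator_def
proof (intro conjI)
  show "subspace (ruling m n s)" by (simp add: ruling_eq_span)
  show "dim (ruling m n s) = 2" unfolding ruling_eq_span
    by (rule dim_span_pair) (use label_nonzero in \<open>simp_all add: frame_point_scale frame_point_eq_iff frame_point_eq_0_iff\<close>)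
  show "ruling m n s \<subseteq> lie_quadric r p m n" by (auto simp: ruling_def lie_quadric_def)
qed

lemma ruling_inj: "ruling m n s = ruling m n s' \<longleftrightarrow> s = s'"
proof
  assume "ruling m n s = ruling m n s'"
  then have "frame_point r m n (p m n) s 0 0 \<in> ruling m n s'" by (metis mem_ruling_iff mult.commute mult_zero_right)
  then show "s = s'" using label_nonzero[of m n] by (simp add: mem_ruling_iff)
qed simp

lemma dim_ruling_inter_edge: "dim (ruling m n s \<inter> common_edge1 r m n) = 1"
proof -
  have "ruling m n s \<inter> common_edge1 r m n = span {frame_point r m n (p m n) s 0 0}"
  proof (rule set_eqI)
    fix X
    show "X \<in> ruling m n s \<inter> common_edge1 r m n \<longleftrightarrow> X \<in> span {frame_point r m n (p m n) s 0 0}"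
    proof
      assume X: "X \<in> ruling m n s \<inter> common_edge1 r m n"
      then obtain v t where "X = lie_point r p m n (1, s) (v, t)" by (auto simp: ruling_def)
      moreover from this X have "t = 0"
        by (auto simp: common_edge1_def lie_point_eq_frame_point mem_edge_iff)
      ultimately have "X = v *\<^sub>R frame_point r m n (p m n) s 0 0"
        by (simp add: lie_point_eq_frame_point frame_point_scale mult.commute)
      then show "X \<in> span {frame_point r m n (p m n) s 0 0}" by (auto simp: span_singleton)
    qed (auto simp: span_singleton frame_point_scale common_edge1_def mem_edge_iff mem_ruling_iff)
  qed
  then show ?thesis using label_nonzero[of m n] by (simp add: frame_point_eq_0_iff)
qed

end

section \<open>Nets with lattice Lie quadrics\<close>

lemma lie_point_swap: "lie_point (swap_lattice r) (swap_lattice p) m n a b = lie_point r p n m b a"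
  by (simp add: lie_point_def swap_lattice_def mult_ac add_ac split: prod.splits)

lemma lie_quadric_swap: "lie_quadric (swap_lattice r) (swap_lattice p) m n = lie_quadric r p n m"
  unfolding lie_quadric_def lie_point_swap by blast

lemma tangent_plane_swap:
  "tangent_plane (swap_lattice r) (swap_lattice p) m n X = tangent_plane r p n m X"
  unfolding tangent_plane_def lie_point_swap by (rule arg_cong[where f = span]) blast

lemma generator_swap: "generator (swap_lattice r) (swap_lattice p) m n L = generator r p n m L"
  by (simp add: generator_def lie_quadric_swap)

lemma common_edge_swap:
  "common_edge1 (swap_lattice r) m n = common_edge2 r n m"
  "common_edge2 (swap_lattice r) m n = common_edge1 r n m"
  by (simp_all add: common_edge1_def common_edge2_def swap_lattice_def)

lemma shared_generator_swap:
  "shared_generator1 (swap_lattice r) (swap_lattice p) m n L = shared_generator2 r p n m L"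
  "shared_generator2 (swap_lattice r) (swap_lattice p) m n L = shared_generator1 r p n m L"
  by (simp_all add: shared_generator1_def shared_generator2_def generator_swap common_edge_swap)

lemma edge_swap: "edge1 (swap_lattice w) m n = edge2 w n m" "edge2 (swap_lattice w) m n = edge1 w n m"
  by (simp_all add: edge1_def edge2_def swap_lattice_def)

lemma off_edges_swap: "off_edges (swap_lattice r) m n X = off_edges r n m X"
  by (auto simp: off_edges_def swap_lattice_def)

lemma discrete_envelope_swap:
  assumes "discrete_envelope r p w"
  shows "discrete_envelope (swap_lattice r) (swap_lattice p) (swap_lattice w)"
  unfolding discrete_envelope_def lie_quadric_swap off_edges_swap edge_swap tangent_plane_swap
    swap_lattice_def[of w]
  using assms unfolding discrete_envelope_def by blast

lemma frames_independent_swap: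
  assumes "frames_independent r" shows "frames_independent (swap_lattice r)"
  unfolding frames_independent_def
proof (intro allI)
  fix m n
  have "{swap_lattice r m n, swap_lattice r (m + 1) n, swap_lattice r m (n + 1), swap_lattice r (m + 1) (n + 1)}
     = {r n m, r (n + 1) m, r n (m + 1), r (n + 1) (m + 1)}"
    by (auto simp: swap_lattice_def)
  then show "independent {swap_lattice r m n, swap_lattice r (m + 1) n, swap_lattice r m (n + 1), swap_lattice r (m + 1) (n + 1)} \<and>
       card {swap_lattice r m n, swap_lattice r (m + 1) n, swap_lattice r m (n + 1), swap_lattice r (m + 1) (n + 1)} = 4"
    using assms by (simp only: frames_independent_def) blast
qed

lemma frame_equations_swap:
  assumes "frame_equations r C" shows "frame_equations (swap_lattice r) (swap_coeffs C)"
  unfolding frame_equations_def swap_coeffs_sel swap_lattice_def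
proof (intro allI)
  fix m n
  show "r n (m + 2) = ga0 C n m *s r n m + ga2 C n m *s r n (m + 1) + ga3 C n m *s r (n + 1) (m + 1) \<and>
    r (n + 1) (m + 2) = de2 C n m *s r n (m + 1) + de1 C n m *s r (n + 1) m + de3 C n m *s r (n + 1) (m + 1) \<and>
    r (n + 2) m = al0 C n m *s r n m + al1 C n m *s r (n + 1) m + al3 C n m *s r (n + 1) (m + 1) \<and>
    r (n + 2) (m + 1) = be2 C n m *s r n (m + 1) + be1 C n m *s r (n + 1) m + be3 C n m *s r (n + 1) (m + 1)"
    using assms unfolding frame_equations_def by (metis add.commute)
qed

lemma regular_coeffs_swap: "regular_coeffs C \<Longrightarrow> regular_coeffs (swap_coeffs C)"
  by (simp add: regular_coeffs_def swap_coeffs_sel)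

lemma lattice_Lie_quadrics_swap:
  "lattice_Lie_quadrics r p \<Longrightarrow> lattice_Lie_quadrics (swap_lattice r) (swap_lattice p)"
  unfolding lattice_Lie_quadrics_def tangent_plane_swap common_edge_swap swap_lattice_def[of p] by blast

locale Lie_net = labelled_frames r p for r p +
  fixes C :: "real coeffs"
  assumes frame_eqs: "frame_equations r C" and regular_C: "regular_coeffs C"
    and Lie_quadrics: "lattice_Lie_quadrics r p"
begin

text \<open>Statements about the second lattice direction are obtained by interpreting the locale at
  the mirrored net.\<close>

lemma swap_net: "Lie_net (swap_lattice r) (swap_lattice p) (swap_coeffs C)"
  by unfold_locales
    (simp_all add: frames label_nonzero frames_independent_swap frame_equations_swap frame_eqs regular_coeffs_swap regular_C
      lattice_Lie_quadrics_swap Lie_quadrics swap_lattice_def[of p])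

lemma coeffs_nonzero:
  "al0 C m n \<noteq> 0" "al3 C m n \<noteq> 0" "be1 C m n \<noteq> 0" "be2 C m n \<noteq> 0"
  "ga0 C m n \<noteq> 0" "ga3 C m n \<noteq> 0" "de1 C m n \<noteq> 0" "de2 C m n \<noteq> 0"
  using regular_C by (auto simp: regular_coeffs_def)

lemma frame_eqs':
  "r (m + 2) n = al0 C m n *\<^sub>R r m n + al1 C m n *\<^sub>R r (m + 1) n + al3 C m n *\<^sub>R r (m + 1) (n + 1)"
  "r (m + 2) (n + 1) =
     be1 C m n *\<^sub>R r (m + 1) n + be2 C m n *\<^sub>R r m (n + 1) + be3 C m n *\<^sub>R r (m + 1) (n + 1)"
  "r m (n + 2) = ga0 C m n *\<^sub>R r m n + ga2 C m n *\<^sub>R r m (n + 1) + ga3 C m n *\<^sub>R r (m + 1) (n + 1)"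
  "r (m + 1) (n + 2) =
     de1 C m n *\<^sub>R r (m + 1) n + de2 C m n *\<^sub>R r m (n + 1) + de3 C m n *\<^sub>R r (m + 1) (n + 1)"
  using frame_eqs unfolding frame_equations_def scalar_mult_eq_scaleR by blast+

lemma frame_point_next1:
  "frame_point r (m + 1) n a b c d = frame_point r m n
     (a * be3 C m n + b * al3 C m n + c) (a * be1 C m n + b * al1 C m n + d) (a * be2 C m n) (b * al0 C m n)"
proof -
  have e: "m + 1 + 1 = m + 2" by simp
  show ?thesis unfolding frame_point_def e frame_eqs'(1,2)[of m n] by (simp add: algebra_simps)
qed

lemma frame_point_next2:
  "frame_point r m (n + 1) a b c d = frame_point r m n
     (a * de3 C m n + c * ga3 C m n + b) (a * de1 C m n) (a * de2 C m n + c * ga2 C m n + d) (c * ga0 C m n)"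
proof -
  have e: "n + 1 + 1 = n + 2" by simp
  show ?thesis unfolding frame_point_def e frame_eqs'(3,4)[of m n] by (simp add: algebra_simps)
qed

text \<open>Of the new frame vectors only \<open>r\<^sub>1\<^sub>1\<^sub>2\<close> has a component
  along \<open>r\<^sub>2\<close> and only \<open>r\<^sub>1\<^sub>1\<close> has one along
  \<open>r\<close>, so the change of frame is inverted by back substitution.\<close>

lemma frame_point_prev1:
  "frame_point r m n a b c d = frame_point r (m + 1) n (c / be2 C m n) (d / al0 C m n)
     (a - c / be2 C m n * be3 C m n - d / al0 C m n * al3 C m n)
     (b - c / be2 C m n * be1 C m n - d / al0 C m n * al1 C m n)"
  unfolding frame_point_next1 using coeffs_nonzero[of m n] by simp

text \<open>The C1 condition is tested at one point of the common edge other than its two vertices.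
  The derivative of \<open>Q\<close> in \<open>t\<close> must be tangent to
  \<open>Q\<^sub>1\<close>; its components along \<open>r\<^sub>2\<close> and \<open>r\<close>
  determine one unknown twice.\<close>

lemma al0_label: "al0 C m n = p m n * p (m + 1) n * be2 C m n"
proof -
  let ?X = "lie_point r p m n (1, 1) (1, 0)"
  have X: "?X = lie_point r p (m + 1) n (p m n, 1) (0, 1)"
    by (simp add: lie_point_eq_frame_point frame_point_next1)
  have nz: "?X \<noteq> 0" using label_nonzero by (simp add: lie_point_eq_frame_point frame_point_eq_0_iff)
  have "?X \<in> common_edge1 r m n"
    by (simp add: common_edge1_def lie_point_eq_frame_point mem_edge_iff)
  then have T: "tangent_plane r p m n ?X = tangent_plane r p (m + 1) n ?X"
    using Lie_quadrics nz unfolding lattice_Lie_quadrics_def by blast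
  have "lie_point r p m n (1, 1) (0, 1) = lie_point r p m n (0, 0) (1, 0) + lie_point r p m n (1, 1) (0, 1)"
    by (simp add: lie_point_eq_frame_point frame_point_add)
  then have "lie_point r p m n (1, 1) (0, 1) \<in> tangent_plane r p m n ?X"
    unfolding tangent_plane_eq[OF nz] by blast
  then have "lie_point r p m n (1, 1) (0, 1)
      \<in> {lie_point r p (m + 1) n c (0, 1) + lie_point r p (m + 1) n (p m n, 1) d | c d. True}"
    unfolding T unfolding X tangent_plane_eq[OF nz[unfolded X]] .
  then obtain c d where "lie_point r p m n (1, 1) (0, 1)
      = lie_point r p (m + 1) n c (0, 1) + lie_point r p (m + 1) n (p m n, 1) d" by blast
  then have "1 = p m n * fst d * p (m + 1) n * be2 C m n" "1 = fst d * al0 C m n"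
    by (auto simp: lie_point_eq_frame_point frame_point_next1 frame_point_add frame_point_eq_iff)
  then show ?thesis by algebra
qed

lemma ga0_label: "ga0 C m n = p m n * p m (n + 1) * de1 C m n"
  using Lie_net.al0_label[OF swap_net, of n m] by (simp add: swap_coeffs_sel swap_lattice_def)

sublocale Lie_coeffs C p
proof
  fix m n :: int
  have r1: "r (m + 1) n = frame_point r m n 0 1 0 0" "r m (n + 1) = frame_point r m n 0 0 1 0"
    "r m n = frame_point r m n 0 0 0 1" "r (m + 1) (n + 1) = frame_point r m n 1 0 0 0" for m n
    by (simp_all add: frame_point_def)
  show "regular_coeffs C" by (rule regular_C)
  show "p m n \<noteq> 0" by (rule label_nonzero)
  show "al0 C m n = p m n * p (m + 1) n * be2 C m n" by (rule al0_label)
  show "ga0 C m n = p m n * p m (n + 1) * de1 C m n" by (rule ga0_label)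
  have "frame_point r (m + 1) n 1 0 0 0
      = al0 C m (n + 1) *\<^sub>R r m (n + 1) + al1 C m (n + 1) *\<^sub>R r (m + 1) (n + 1) + al3 C m (n + 1) *\<^sub>R frame_point r m (n + 1) 1 0 0 0"
    using frame_eqs'(1)[of m "n + 1"] by (simp add: frame_point_def add.commute)
  then have "frame_point r (m + 1) n 1 0 0 0
      = al0 C m (n + 1) *\<^sub>R frame_point r m n 0 0 1 0 + al1 C m (n + 1) *\<^sub>R frame_point r m n 1 0 0 0
       + al3 C m (n + 1) *\<^sub>R frame_point r m (n + 1) 1 0 0 0"
    by (simp only: r1(2)[of m n] r1(4)[of m n])
  then show "be1 C m n = al3 C m (n + 1) * de1 C m n"
    "be2 C m n = al0 C m (n + 1) + al3 C m (n + 1) * de2 C m n"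
    "be3 C m n = al1 C m (n + 1) + al3 C m (n + 1) * de3 C m n"
    by (simp_all add: frame_point_next1 frame_point_next2 frame_point_scale frame_point_add frame_point_eq_iff)
  have "frame_point r m (n + 1) 1 0 0 0
      = ga0 C (m + 1) n *\<^sub>R r (m + 1) n + ga2 C (m + 1) n *\<^sub>R r (m + 1) (n + 1) + ga3 C (m + 1) n *\<^sub>R frame_point r (m + 1) n 1 0 0 0"
    using frame_eqs'(3)[of "m + 1" n] by (simp add: frame_point_def add.commute)
  then have "frame_point r m (n + 1) 1 0 0 0
      = ga0 C (m + 1) n *\<^sub>R frame_point r m n 0 1 0 0 + ga2 C (m + 1) n *\<^sub>R frame_point r m n 1 0 0 0
       + ga3 C (m + 1) n *\<^sub>R frame_point r (m + 1) n 1 0 0 0"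
    by (simp only: r1(1)[of m n] r1(4)[of m n])
  then show "de1 C m n = ga0 C (m + 1) n + ga3 C (m + 1) n * be1 C m n"
    "de2 C m n = ga3 C (m + 1) n * be2 C m n"
    "de3 C m n = ga2 C (m + 1) n + ga3 C (m + 1) n * be3 C m n"
    by (simp_all add: frame_point_next1 frame_point_next2 frame_point_scale frame_point_add frame_point_eq_iff)
  have "r (m + 2) (n + 2) = frame_point r m (n + 1) (be3 C m (n + 1)) (be1 C m (n + 1)) (be2 C m (n + 1)) 0"
    using frame_eqs'(2)[of m "n + 1"] by (simp add: frame_point_def add_ac)
  moreover have "r (m + 2) (n + 2) = frame_point r (m + 1) n (de3 C (m + 1) n) (de1 C (m + 1) n) (de2 C (m + 1) n) 0"
    using frame_eqs'(4)[of "m + 1" n] by (simp add: frame_point_def add_ac)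
  ultimately have "frame_point r m (n + 1) (be3 C m (n + 1)) (be1 C m (n + 1)) (be2 C m (n + 1)) 0
     = frame_point r (m + 1) n (de3 C (m + 1) n) (de1 C (m + 1) n) (de2 C (m + 1) n) 0" by simp
  then show "be3 C m (n + 1) * de1 C m n = de1 C (m + 1) n * al1 C m n + de3 C (m + 1) n * be1 C m n"
    "be2 C m (n + 1) * ga2 C m n + be3 C m (n + 1) * de2 C m n = de3 C (m + 1) n * be2 C m n"
    "be1 C m (n + 1) + be2 C m (n + 1) * ga3 C m n + be3 C m (n + 1) * de3 C m n
       = de1 C (m + 1) n * al3 C m n + de2 C (m + 1) n + de3 C (m + 1) n * be3 C m n"
    unfolding frame_point_next1 frame_point_next2 frame_point_eq_iff by (simp_all add: algebra_simps)
qed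


section \<open>Tangency along an edge and shared generators\<close>

lemma lie_point_next1:
  "lie_point r p (m + 1) n (1, s) (1, t) = frame_point r m n
     (p (m + 1) n * be3 C m n + s * al3 C m n + t) (p (m + 1) n * be1 C m n + s * al1 C m n + s * t)
     (p (m + 1) n * be2 C m n) (s * al0 C m n)"
  by (simp add: lie_point_eq_frame_point frame_point_next1)

lemma touching_iff:
  assumes "k \<noteq> 0" "k' \<noteq> 0" "t \<noteq> 0"
  shows "lie_point r p (m + 1) n (1, s') (1, t') \<in> tangent_plane r p m n (k *\<^sub>R lie_point r p m n (1, s) (1, t)) \<and>
     lie_point r p m n (1, s) (1, t) \<in> tangent_plane r p (m + 1) n (k' *\<^sub>R lie_point r p (m + 1) n (1, s') (1, t'))
   \<longleftrightarrow> conj_form C p m n s s' = 0 \<and>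
     (p m n * s' = s \<or> moves (swap_coeffs C) (swap_lattice p) n m t t')"
    (is "?A \<and> ?B \<longleftrightarrow> _")
proof -
  let ?p = "p m n" and ?p' = "p (m + 1) n" and ?a0 = "al0 C m n" and ?a1 = "al1 C m n" and ?a3 = "al3 C m n"
    and ?b1 = "be1 C m n" and ?b2 = "be2 C m n" and ?b3 = "be3 C m n"
  \<comment> \<open>Once the product of \<open>al0 - t * t'\<close> and \<open>p * s' - s\<close> is
    split off, what remains of each tangency condition is \<open>t\<close> times an expression in
    \<open>s\<close> and \<open>s'\<close> alone: \<open>W\<close> at one end, \<open>V\<close> at
    the other.\<close>
  define W where "W = s * s' * ?a3 + s * ?p' * ?b3 - ?p * s' * ?a1 - ?p * ?p' * ?b1"
  define V where "V = s * s' * ?a3 + ?p * ?p' * s' * ?b3 - s * ?a1 - ?p * ?p' * ?b1"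
  have A: "?A \<longleftrightarrow> (?a0 - t * t') * (?p * s' - s) + t * W = 0"
    unfolding lie_point_next1 mem_tangent_plane_iff[OF assms(1)] al0_label W_def
    by (auto simp: algebra_simps)
  define c d where "c = t / ?b2" and "d = s * t / ?a0"
  have c: "c * ?b2 = t" and d: "d * ?a0 = s * t" using coeffs_nonzero[of m n] by (simp_all add: c_def d_def)
  have "?B \<longleftrightarrow> frame_point r (m + 1) n c d (?p - c * ?b3 - d * ?a3) (s - c * ?b1 - d * ?a1)
      \<in> tangent_plane r p (m + 1) n (k' *\<^sub>R lie_point r p (m + 1) n (1, s') (1, t'))"
    unfolding c_def d_def lie_point_eq_frame_point[of r p m n] by (subst frame_point_prev1) simp
  also have "\<dots> \<longleftrightarrow> ?p' * (s - c * ?b1 - d * ?a1) + c * s' * t'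
      = ?p' * (s' * (?p - c * ?b3 - d * ?a3) + t' * d)"
    by (rule mem_tangent_plane_iff[OF assms(2)])
  \<comment> \<open>The factor clears the denominators in \<open>c\<close> and \<open>d\<close>,
    because \<open>al0\<close> is the product of \<open>be2\<close> and the two labels.\<close>
  also have "\<dots> \<longleftrightarrow> ?p * ?b2 * (?p' * (s - c * ?b1 - d * ?a1) + c * s' * t'
      - ?p' * (s' * (?p - c * ?b3 - d * ?a3) + t' * d)) = 0"
    using label_nonzero coeffs_nonzero by simp
  also have "?p * ?b2 * (?p' * (s - c * ?b1 - d * ?a1) + c * s' * t'
      - ?p' * (s' * (?p - c * ?b3 - d * ?a3) + t' * d)) = - (?a0 - t * t') * (?p * s' - s) + t * V"
    using al0_label[of m n] c d unfolding V_def by algebra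
  finally have B: "?B \<longleftrightarrow> - (?a0 - t * t') * (?p * s' - s) + t * V = 0" .
  \<comment> \<open>The sum of the two tangency conditions is the bilinear equation, their difference factorises.\<close>
  have J: "W + V = conj_form C p m n s s'" unfolding W_def V_def conj_form_def conj_coeff_def by algebra
  have G: "2 * (?a0 - t * t') * (?p * s' - s) + t * (W - V)
      = (?p * s' - s) * (2 * ?a0 - 2 * t * t' - t * (?a1 + ?p' * ?b3))"
    unfolding W_def V_def by algebra
  have M: "moves (swap_coeffs C) (swap_lattice p) n m t t' \<longleftrightarrow> 2 * ?a0 - 2 * t * t' - t * (?a1 + ?p' * ?b3) = 0"
    by (auto simp: moves_def move_coeff_def swap_coeffs_sel swap_lattice_def algebra_simps)
  have "?A \<and> ?B \<longleftrightarrow> t * (W + V) = 0 \<and> 2 * (?a0 - t * t') * (?p * s' - s) + t * (W - V) = 0"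
    unfolding A B by (auto simp: algebra_simps)
  then show ?thesis unfolding J G M using assms(3) by auto
qed

text \<open>Here \<open>c\<close> and \<open>d\<close> are the first two coordinates, in the frame
  of \<open>Q\<^sub>1\<close>, of a point on the generator \<open>s\<close> of \<open>Q\<close>. The
  assumption on \<open>d\<close> is one of the two equations of the generator \<open>q\<close> of
  \<open>Q\<^sub>1\<close>; the difference on the left is the other one.\<close>

lemma conj_form_next1:
  assumes q: "q * p m n = s" and d: "p (m + 1) n * d = q * c" and y: "p m n * y1 = s * y12"
  shows "2 * p m n * p (m + 1) n * (y1 - c * be1 C m n - d * al1 C m n
     - q * (y12 - c * be3 C m n - d * al3 C m n)) = c * conj_form C p m n s q"
proof -
  have "p m n * y1 = p m n * (q * y12)" using y unfolding q[symmetric] by simp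
  then have y1: "y1 = q * y12" using label_nonzero by simp
  have "2 * p m n * p (m + 1) n * (y1 - c * be1 C m n - d * al1 C m n
      - q * (y12 - c * be3 C m n - d * al3 C m n))
    = 2 * p m n * (- p (m + 1) n * c * be1 C m n - (p (m + 1) n * d) * al1 C m n
      + q * (p (m + 1) n * c * be3 C m n + (p (m + 1) n * d) * al3 C m n))"
    unfolding y1 by (simp add: algebra_simps)
  also have "\<dots> = c * conj_form C p m n s q"
    unfolding d unfolding conj_form_def conj_coeff_def q[symmetric] by (simp add: algebra_simps)
  finally show ?thesis .
qed

lemma ruling_next1:
  assumes "conj_form C p m n s (s / p m n) = 0"
  shows "ruling m n s \<subseteq> ruling (m + 1) n (s / p m n)"
proof
  fix X assume "X \<in> ruling m n s"
  then obtain v t where X: "X = frame_point r m n (p m n * v) (s * v) t (s * t)"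
    unfolding ruling_def using lie_point_eq_frame_point[of r p m n "(1, s)"]
    by (force simp: mult.commute)
  define q c d where "q = s / p m n" and "c = t / be2 C m n" and "d = s * t / al0 C m n"
  have qcd: "q * p m n = s" "c * be2 C m n = t" "d * al0 C m n = s * t"
    using label_nonzero coeffs_nonzero by (simp_all add: q_def c_def d_def)
  have "be2 C m n * p m n * (p (m + 1) n * d) = d * al0 C m n" by (simp add: al0_label)
  also have "\<dots> = (q * p m n) * (c * be2 C m n)" by (simp only: qcd)
  finally have "be2 C m n * p m n * (p (m + 1) n * d) = be2 C m n * p m n * (q * c)" by simp
  then have 1: "p (m + 1) n * d = q * c" using label_nonzero coeffs_nonzero by simp
  have "2 * p m n * p (m + 1) n * (s * v - c * be1 C m n - d * al1 C m n
      - q * (p m n * v - c * be3 C m n - d * al3 C m n)) = c * conj_form C p m n s q"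
    by (rule conj_form_next1) (simp_all add: qcd 1)
  then have 2: "s * v - c * be1 C m n - d * al1 C m n = q * (p m n * v - c * be3 C m n - d * al3 C m n)"
    using assms label_nonzero by (simp add: q_def)
  show "X \<in> ruling (m + 1) n (s / p m n)"
    unfolding X by (subst frame_point_prev1) (use 1 2 in \<open>simp add: mem_ruling_iff q_def c_def d_def\<close>)
qed

text \<open>
  A shared generator is totally isotropic for both quadratic forms, and it meets the common edge,
  which fixes its parameter.
\<close>

lemma shared_generator1_iff:
  "shared_generator1 r p m n L \<longleftrightarrow> (\<exists>s. conj_form C p m n s (s / p m n) = 0 \<and> L = ruling m n s)"
proof
  assume "\<exists>s. conj_form C p m n s (s / p m n) = 0 \<and> L = ruling m n s"
  then obtain s where s: "conj_form C p m n s (s / p m n) = 0" "L = ruling m n s" by blast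
  show "shared_generator1 r p m n L"
    using generator_ruling[of m n s] generator_ruling[of "m + 1" n "s / p m n"] ruling_next1[OF s(1)]
      dim_ruling_inter_edge[of m n s] unfolding shared_generator1_def generator_def s(2) by blast
next
  assume "shared_generator1 r p m n L"
  then have L: "subspace L" "dim L = 2" "L \<subseteq> lie_quadric r p m n" "L \<subseteq> lie_quadric r p (m + 1) n"
    and dE: "dim (L \<inter> common_edge1 r m n) = 1"
    by (auto simp: shared_generator1_def generator_def)
  have "\<not> L \<inter> common_edge1 r m n \<subseteq> {0}"
  proof
    assume "L \<inter> common_edge1 r m n \<subseteq> {0}"
    then show False using dE by (simp flip: dim_eq_0)
  qed
  then obtain X where X: "X \<in> L" "X \<in> common_edge1 r m n" "X \<noteq> 0" by blast
  have "\<not> L \<subseteq> common_edge1 r m n"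
  proof
    assume "L \<subseteq> common_edge1 r m n"
    then have "L \<inter> common_edge1 r m n = L" by blast
    then show False using dE L(2) by simp
  qed
  then obtain Y where Y: "Y \<in> L" "Y \<notin> common_edge1 r m n" by blast
  obtain x12 x1 x2 x0 where Xf: "X = frame_point r m n x12 x1 x2 x0"
    using X(1) L(3) by (auto simp: lie_quadric_def lie_point_eq_frame_point)
  obtain y12 y1 y2 y0 where Yf: "Y = frame_point r m n y12 y1 y2 y0"
    using Y(1) L(3) by (auto simp: lie_quadric_def lie_point_eq_frame_point)
  have x: "x2 = 0" "x0 = 0" using X(2) unfolding Xf common_edge1_def mem_edge_iff by auto
  have ynz: "y2 \<noteq> 0 \<or> y0 \<noteq> 0" using Y(2) unfolding Yf common_edge1_def mem_edge_iff by auto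
  have XY: "X + Y \<in> L" using L(1) X(1) Y(1) by (rule subspace_add)
  have yQ: "y12 * y0 = p m n * y1 * y2"
    using Y(1) L(3) frame_point_in_quadric_iff[of m n] unfolding Yf by blast
  have "X + Y \<in> lie_quadric r p m n" using XY L(3) by blast
  then have "(x12 + y12) * y0 = p m n * (x1 + y1) * y2"
    unfolding Xf Yf frame_point_add frame_point_in_quadric_iff by (simp add: x)
  then have xyQ: "x12 * y0 = p m n * x1 * y2" using yQ by (simp add: algebra_simps)
  define c d where "c = y2 / be2 C m n" and "d = y0 / al0 C m n"
  have cd: "c * be2 C m n = y2" "d * al0 C m n = y0" using coeffs_nonzero[of m n] by (simp_all add: c_def d_def)
  have "Y \<in> lie_quadric r p (m + 1) n" using Y L by blast
  then have yQ1: "c * (y1 - c * be1 C m n - d * al1 C m n)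
      = p (m + 1) n * d * (y12 - c * be3 C m n - d * al3 C m n)"
    unfolding Yf frame_point_prev1[of m n] frame_point_in_quadric_iff c_def d_def .
  \<comment> \<open>Otherwise \<open>Y\<close> would lie on the extended edge through
    \<open>r\<close> and \<open>r\<^sub>1\<close>, at a point other than \<open>r\<^sub>1\<close>.
    Such a point is not on \<open>Q\<^sub>1\<close>, since \<open>al3\<close> is nonzero.\<close>
  have y2: "y2 \<noteq> 0"
  proof
    assume y2: "y2 = 0"
    then have y0: "y0 \<noteq> 0" using ynz by simp
    then have "y12 = 0" using yQ y2 by simp
    moreover have "c = 0" "d \<noteq> 0" using y2 y0 coeffs_nonzero by (simp_all add: c_def d_def)
    ultimately show False using yQ1 label_nonzero coeffs_nonzero by simp
  qed
  define s where "s = y0 / y2"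
  have y0: "y0 = s * y2" using y2 by (simp add: s_def)
  have sx: "p m n * x1 = s * x12" and sy: "p m n * y1 = s * y12"
    using xyQ yQ y2 unfolding y0 by (simp_all add: mult.commute)
  have sub: "{X, Y} \<subseteq> ruling m n s" by (simp add: Xf Yf mem_ruling_iff x sx sy y0)
  have dim2: "dim (span {X, Y}) = 2"
    by (rule dim_span_pair) (use X(3) y2 in \<open>auto simp: Xf Yf frame_point_scale frame_point_eq_iff x\<close>)
  have "span {X, Y} = L"
    by (rule subspace_dim_equal) (use L X Y dim2 in \<open>simp_all add: span_minimal\<close>)
  moreover have "span {X, Y} = ruling m n s"
    by (rule subspace_dim_equal)
      (use generator_ruling[of m n s] sub dim2 in \<open>simp_all add: span_minimal generator_def\<close>)
  moreover have "conj_form C p m n s (s / p m n) = 0"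
  proof -
    define q where "q = s / p m n"
    have q: "q * p m n = s" using label_nonzero by (simp add: q_def)
    have "be2 C m n * p m n * (p (m + 1) n * d) = d * al0 C m n" by (simp add: al0_label)
    also have "\<dots> = (q * p m n) * (c * be2 C m n)" by (simp only: q cd y0)
    finally have "be2 C m n * p m n * (p (m + 1) n * d) = be2 C m n * p m n * (q * c)" by simp
    then have 1: "p (m + 1) n * d = q * c" using label_nonzero coeffs_nonzero by simp
    have c: "c \<noteq> 0" using y2 cd by auto
    have "c * (y1 - c * be1 C m n - d * al1 C m n) = c * (q * (y12 - c * be3 C m n - d * al3 C m n))"
      using yQ1 unfolding 1 by simp
    then have "y1 - c * be1 C m n - d * al1 C m n - q * (y12 - c * be3 C m n - d * al3 C m n) = 0"
      using c by simp
    then show ?thesis using conj_form_next1[OF q 1 sy] c by (simp add: q_def)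
  qed
  ultimately show "\<exists>s. conj_form C p m n s (s / p m n) = 0 \<and> L = ruling m n s" by blast
qed

lemma conj_form_diag:
  "conj_form C p m n s (s / p m n) = (2 * al3 C m n / p m n) * s\<^sup>2 + (2 * conj_coeff C p m n) * s
     + - (2 * p m n * p (m + 1) n * be1 C m n)"
  using label_nonzero[of m n] by (simp add: conj_form_def field_simps power2_eq_square)

lemma ex1_shared_generator1_iff: "(\<exists>!L. shared_generator1 r p m n L) \<longleftrightarrow> disc C p m n = 0"
proof -
  have "(\<exists>!L. shared_generator1 r p m n L) \<longleftrightarrow> (\<exists>!s. conj_form C p m n s (s / p m n) = 0)"
  proof
    assume ex1: "\<exists>!L. shared_generator1 r p m n L"
    then obtain s where s: "conj_form C p m n s (s / p m n) = 0" unfolding shared_generator1_iff by blast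
    moreover have "s' = s" if "conj_form C p m n s' (s' / p m n) = 0" for s'
    proof -
      have "shared_generator1 r p m n (ruling m n s)" "shared_generator1 r p m n (ruling m n s')"
        using s that unfolding shared_generator1_iff by blast+
      with ex1 have "ruling m n s' = ruling m n s" by blast
      then show ?thesis by (simp only: ruling_inj)
    qed
    ultimately show "\<exists>!s. conj_form C p m n s (s / p m n) = 0" by (rule ex1I)
  next
    assume "\<exists>!s. conj_form C p m n s (s / p m n) = 0"
    then show "\<exists>!L. shared_generator1 r p m n L" unfolding shared_generator1_iff by blast
  qed
  also have "\<dots> \<longleftrightarrow> discrim (2 * al3 C m n / p m n) (2 * conj_coeff C p m n)
      (- (2 * p m n * p (m + 1) n * be1 C m n)) = 0"
    unfolding conj_form_diag by (rule ex1_quadratic_root_iff) (simp add: label_nonzero coeffs_nonzero)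
  also have "discrim (2 * al3 C m n / p m n) (2 * conj_coeff C p m n)
      (- (2 * p m n * p (m + 1) n * be1 C m n)) = 4 * disc C p m n"
    using label_nonzero[of m n] by (simp add: discrim_def disc_def power2_eq_square field_simps)
  also have "4 * disc C p m n = 0 \<longleftrightarrow> disc C p m n = 0" by simp
  finally show ?thesis .
qed

text \<open>A shared generator through the vertex on \<open>Q\<close> can only be the one with
  parameter \<open>s\<close>. The components along \<open>r\<^sub>2\<close> and \<open>r\<close> of
  the vertex on \<open>Q\<^sub>1\<close> then yield \<open>p * s' = s\<close>; conversely, the
  bilinear equation supplies the remaining incidence.\<close>

lemma shared_edge_iff:
  assumes "k \<noteq> 0" "k' \<noteq> 0" "conj_form C p m n s s' = 0"
    and dim2: "dim (span {k *\<^sub>R lie_point r p m n (1, s) (1, t), k' *\<^sub>R lie_point r p (m + 1) n (1, s') (1, t')}) = 2"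
      (is "dim ?E = 2")
  shows "shared_generator1 r p m n ?E \<longleftrightarrow> p m n * s' = s"
proof -
  have in1: "k *\<^sub>R lie_point r p m n (1, s) (1, t) \<in> ruling m n x \<longleftrightarrow> s = x" for x
    using assms(1) label_nonzero[of m n]
    by (auto simp: lie_point_eq_frame_point frame_point_scale mem_ruling_iff)
  show ?thesis
  proof
    assume "shared_generator1 r p m n ?E"
    then obtain x where x: "?E = ruling m n x" unfolding shared_generator1_iff by blast
    have "k *\<^sub>R lie_point r p m n (1, s) (1, t) \<in> ?E" "k' *\<^sub>R lie_point r p (m + 1) n (1, s') (1, t') \<in> ?E"
      by (simp_all add: span_base)
    then have "k' *\<^sub>R lie_point r p (m + 1) n (1, s') (1, t') \<in> ruling m n s"
      unfolding x in1 by simp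
    then have "s' * al0 C m n = s * (p (m + 1) n * be2 C m n)"
      unfolding lie_point_next1 frame_point_scale mem_ruling_iff using assms(2) by simp
    then have "p (m + 1) n * be2 C m n * (p m n * s') = p (m + 1) n * be2 C m n * s"
      using al0_label[of m n] by algebra
    then show "p m n * s' = s" using label_nonzero coeffs_nonzero by simp
  next
    assume s': "p m n * s' = s"
    then have "s' = s / p m n" using label_nonzero[of m n] by (simp add: field_simps)
    then have root: "conj_form C p m n s (s / p m n) = 0" using assms(3) by simp
    have "2 * (p m n * (p (m + 1) n * be1 C m n + s' * al1 C m n + s' * t')
        - s * (p (m + 1) n * be3 C m n + s' * al3 C m n + t')) = 0"
      using assms(3) s' unfolding conj_form_def conj_coeff_def by algebra
    moreover have "s' * al0 C m n = s * (p (m + 1) n * be2 C m n)" unfolding s'[symmetric] al0_label by simp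
    ultimately have "lie_point r p (m + 1) n (1, s') (1, t') \<in> ruling m n s"
      unfolding lie_point_next1 mem_ruling_iff by simp
    then have "k' *\<^sub>R lie_point r p (m + 1) n (1, s') (1, t') \<in> ruling m n s"
      using generator_ruling by (simp add: generator_def subspace_scale)
    then have "?E = ruling m n s"
      using in1 dim2 generator_ruling[of m n s]
      by (intro subspace_dim_equal) (simp_all add: span_minimal generator_def)
    then show "shared_generator1 r p m n ?E" using root unfolding shared_generator1_iff by blast
  qed
qed

lemma dim_edge:
  assumes "p m n * s' \<noteq> s"
  shows "dim (span {lie_point r p m n (1, s) (1, t), lie_point r p (m + 1) n (1, s') (1, t')}) = 2"
proof (rule dim_span_pair)
  show "lie_point r p m n (1, s) (1, t) \<noteq> 0"
    using label_nonzero by (simp add: lie_point_eq_frame_point frame_point_eq_0_iff)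
  show "lie_point r p (m + 1) n (1, s') (1, t') \<noteq> k *\<^sub>R lie_point r p m n (1, s) (1, t)" for k
  proof
    assume "lie_point r p (m + 1) n (1, s') (1, t') = k *\<^sub>R lie_point r p m n (1, s) (1, t)"
    then have "p (m + 1) n * be2 C m n = k * t" "s' * al0 C m n = k * s * t"
      unfolding lie_point_next1 lie_point_eq_frame_point[of r p m n] frame_point_scale frame_point_eq_iff by auto
    then have "p (m + 1) n * be2 C m n * (p m n * s') = p (m + 1) n * be2 C m n * s"
      using al0_label[of m n] by algebra
    then show False using assms label_nonzero coeffs_nonzero by simp
  qed
qed

section \<open>Envelopes and the obstruction\<close>

lemma tangent_plane_span_subset:
  "span {X, Y} \<subseteq> tangent_plane r p m n Z \<longleftrightarrow> X \<in> tangent_plane r p m n Z \<and> Y \<in> tangent_plane r p m n Z"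
proof
  assume "span {X, Y} \<subseteq> tangent_plane r p m n Z"
  then show "X \<in> tangent_plane r p m n Z \<and> Y \<in> tangent_plane r p m n Z"
    using span_superset[of "{X, Y}"] by blast
qed (auto simp: tangent_plane_def intro!: span_minimal del: subsetI)

lemma scale_mem_tangent_plane:
  assumes "k \<noteq> 0"
  shows "k *\<^sub>R X \<in> tangent_plane r p m n Z \<longleftrightarrow> X \<in> tangent_plane r p m n Z"
proof
  have T: "subspace (tangent_plane r p m n Z)" by (simp add: tangent_plane_def)
  show "X \<in> tangent_plane r p m n Z" if "k *\<^sub>R X \<in> tangent_plane r p m n Z"
    using subspace_scale[OF T that, of "inverse k"] assms by simp
  show "k *\<^sub>R X \<in> tangent_plane r p m n Z" if "X \<in> tangent_plane r p m n Z"
    using that by (rule subspace_scale[OF T])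
qed

lemma self_mem_tangent_plane:
  assumes "k \<noteq> 0"
  shows "lie_point r p m n (1, s) (1, t) \<in> tangent_plane r p m n (k *\<^sub>R lie_point r p m n (1, s) (1, t))"
proof -
  have "frame_point r m n (p m n) s t (s * t) \<in> tangent_plane r p m n (k *\<^sub>R lie_point r p m n (1, s) (1, t))"
    by (simp add: mem_tangent_plane_iff[OF assms] algebra_simps)
  then show ?thesis using lie_point_eq_frame_point[of r p m n "(1, s)" "(1, t)"] by simp
qed


lemma envelope_edge:
  assumes env: "discrete_envelope r p w"
    and w: "\<And>m n. w m n = k m n *\<^sub>R lie_point r p m n (1, s m n) (1, t m n)"
    and nz: "\<And>m n. k m n \<noteq> 0" "\<And>m n. t m n \<noteq> 0"
  shows "conj_form C p m n (s m n) (s (m + 1) n) = 0"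
    and "p m n * s (m + 1) n = s m n \<or> moves (swap_coeffs C) (swap_lattice p) n m (t m n) (t (m + 1) n)"
    and "shared_generator1 r p m n (edge1 w m n) \<longleftrightarrow> p m n * s (m + 1) n = s m n"
proof -
  have e: "edge1 w m n \<subseteq> tangent_plane r p m n (w m n)"
    "edge1 w (m + 1 - 1) n \<subseteq> tangent_plane r p (m + 1) n (w (m + 1) n)"
    "dim (edge1 w m n) = 2"
    using env unfolding discrete_envelope_def by blast+
  have "w (m + 1) n \<in> tangent_plane r p m n (w m n)" "w m n \<in> tangent_plane r p (m + 1) n (w (m + 1) n)"
    using e(1,2) by (simp_all add: edge1_def tangent_plane_span_subset)
  then have "lie_point r p (m + 1) n (1, s (m + 1) n) (1, t (m + 1) n)
      \<in> tangent_plane r p m n (k m n *\<^sub>R lie_point r p m n (1, s m n) (1, t m n)) \<and>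
    lie_point r p m n (1, s m n) (1, t m n)
      \<in> tangent_plane r p (m + 1) n (k (m + 1) n *\<^sub>R lie_point r p (m + 1) n (1, s (m + 1) n) (1, t (m + 1) n))"
    unfolding w[of m n] w[of "m + 1" n] using scale_mem_tangent_plane nz(1) by blast
  from this[unfolded touching_iff[OF nz(1) nz(1) nz(2)]]
  show J: "conj_form C p m n (s m n) (s (m + 1) n) = 0"
    and "p m n * s (m + 1) n = s m n \<or> moves (swap_coeffs C) (swap_lattice p) n m (t m n) (t (m + 1) n)"
    by blast+
  show "shared_generator1 r p m n (edge1 w m n) \<longleftrightarrow> p m n * s (m + 1) n = s m n"
    using shared_edge_iff[OF nz(1) nz(1) J] e(3) unfolding edge1_def w[of m n] w[of "m + 1" n] by blast
qed

lemma obstruction_of_envelope: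
  assumes env: "discrete_envelope r p w"
    and ns: "\<And>m n. \<not> shared_generator2 r p m n (edge2 w m n)"
  shows "obstruction C p m n = 0"
proof -
  have "\<exists>k s t. k \<noteq> 0 \<and> s \<noteq> 0 \<and> t \<noteq> 0 \<and> w m n = k *\<^sub>R lie_point r p m n (1, s) (1, t)" for m n
  proof -
    have "w m n \<in> lie_quadric r p m n" "off_edges r m n (w m n)"
      using env unfolding discrete_envelope_def by blast+
    then show ?thesis by (rule off_edge_point) blast
  qed
  then obtain k s t where nz: "\<And>m n. k m n \<noteq> 0" "\<And>m n. s m n \<noteq> 0" "\<And>m n. t m n \<noteq> 0"
    and w: "\<And>m n. w m n = k m n *\<^sub>R lie_point r p m n (1, s m n) (1, t m n)" by metis
  interpret sw: Lie_net "swap_lattice r" "swap_lattice p" "swap_coeffs C" by (rule swap_net)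
  have w': "swap_lattice w m n = swap_lattice k m n *\<^sub>R
      lie_point (swap_lattice r) (swap_lattice p) m n (1, swap_lattice t m n) (1, swap_lattice s m n)" for m n
    unfolding lie_point_swap by (simp add: swap_lattice_def w)
  note sw_edge = sw.envelope_edge[OF discrete_envelope_swap[OF env] w']
  \<comment> \<open>For an edge of the second direction the alternative of the mirrored statement is
    ruled out by \<open>ns\<close>, so \<open>s\<close> follows its Moebius map.\<close>
  have mv: "moves C p m n (s m n) (s m (n + 1))" for m n
    using sw_edge(2)[of n m] sw_edge(3)[of n m] ns[of m n] nz
    unfolding shared_generator_swap edge_swap swap_coeffs_swap_coeffs swap_lattice_swap_lattice
    by (auto simp: swap_lattice_def)
  have J: "conj_form C p m n (s m n) (s (m + 1) n) = 0" for m n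
    by (rule envelope_edge(1)[OF env w]) (rule nz)+
  show ?thesis
    using conj_form_moves[OF mv[of m n] mv[of "m + 1" n]] J[of m n] J[of m "n + 1"] nz(2) by simp
qed

lemma edge_touches:
  assumes w: "\<And>m n. w m n = lie_point r p m n (1, s m n) (1, t m n)"
    and nz: "t m n \<noteq> 0"
    and J: "conj_form C p m n (s m n) (s (m + 1) n) = 0"
    and mv: "moves (swap_coeffs C) (swap_lattice p) n m (t m n) (t (m + 1) n)"
    and ne: "p m n * s (m + 1) n \<noteq> s m n"
  shows "dim (edge1 w m n) = 2" "edge1 w m n \<subseteq> tangent_plane r p m n (w m n)"
    "edge1 w m n \<subseteq> tangent_plane r p (m + 1) n (w (m + 1) n)"
    "\<not> shared_generator1 r p m n (edge1 w m n)"
proof -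
  show dim: "dim (edge1 w m n) = 2" unfolding edge1_def w using ne by (rule dim_edge)
  have "w (m + 1) n \<in> tangent_plane r p m n (w m n) \<and> w m n \<in> tangent_plane r p (m + 1) n (w (m + 1) n)"
    using touching_iff[of 1 1 "t m n"] nz J mv unfolding w by simp
  moreover have "w m n \<in> tangent_plane r p m n (w m n)" for m n
    using self_mem_tangent_plane[of 1] unfolding w by simp
  ultimately show "edge1 w m n \<subseteq> tangent_plane r p m n (w m n)"
    "edge1 w m n \<subseteq> tangent_plane r p (m + 1) n (w (m + 1) n)"
    unfolding edge1_def tangent_plane_span_subset by blast+
  show "\<not> shared_generator1 r p m n (edge1 w m n)"
    using shared_edge_iff[of 1 1 m n, OF _ _ J] ne dim unfolding edge1_def w by simp
qed

text \<open>Homogeneity makes \<open>disc\<close> vanish everywhere or nowhere, so one of the two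
  constructions of columns applies to the whole lattice.\<close>

lemma parameters_exist:
  assumes "\<And>m n. obstruction C p m n = 0"
    and "(\<forall>m n. \<exists>!L. shared_generator1 r p m n L) \<or> (\<forall>m n. \<not> (\<exists>!L. shared_generator1 r p m n L))"
  shows "\<exists>s. \<forall>m n. s m n \<noteq> 0 \<and> moves C p m n (s m n) (s m (n + 1)) \<and>
    conj_form C p m n (s m n) (s (m + 1) n) = 0 \<and> p m n * s (m + 1) n \<noteq> s m n"
proof -
  have "(\<forall>m n. disc C p m n = 0) \<or> (\<forall>m n. disc C p m n \<noteq> 0)"
    using assms(2) unfolding ex1_shared_generator1_iff .
  then have "\<exists>s. \<forall>m. column m (s m) \<and> (\<forall>n. conj_form C p m n (s m n) (s (m + 1) n) = 0
           \<and> p m n * s (m + 1) n \<noteq> s m n)"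
    using columns_of_disc_zero columns_of_disc_nz assms(1) by blast
  then show ?thesis unfolding column_def by blast
qed

lemma PMQ_of_obstruction:
  assumes ob: "\<And>m n. obstruction C p m n = 0" and hom: "homogeneous_quadrics r p"
  shows "PMQ_wrt r p"
proof -
  interpret sw: Lie_net "swap_lattice r" "swap_lattice p" "swap_coeffs C" by (rule swap_net)
  have hom1: "(\<forall>m n. \<exists>!L. shared_generator1 r p m n L) \<or> (\<forall>m n. \<not> (\<exists>!L. shared_generator1 r p m n L))"
    using hom by (simp add: homogeneous_quadrics_def)
  obtain s where "\<forall>m n. s m n \<noteq> 0 \<and> moves C p m n (s m n) (s m (n + 1)) \<and>
      conj_form C p m n (s m n) (s (m + 1) n) = 0 \<and> p m n * s (m + 1) n \<noteq> s m n"
    using parameters_exist[OF ob hom1] by (rule exE)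
  then have s: "\<And>m n. s m n \<noteq> 0" "\<And>m n. moves C p m n (s m n) (s m (n + 1))"
    "\<And>m n. conj_form C p m n (s m n) (s (m + 1) n) = 0" "\<And>m n. p m n * s (m + 1) n \<noteq> s m n"
    by simp_all
  have hom2: "(\<forall>m n. \<exists>!L. shared_generator1 (swap_lattice r) (swap_lattice p) m n L)
    \<or> (\<forall>m n. \<not> (\<exists>!L. shared_generator1 (swap_lattice r) (swap_lattice p) m n L))"
  proof -
    have "(\<forall>m n. \<exists>!L. shared_generator2 r p m n L) \<or> (\<forall>m n. \<not> (\<exists>!L. shared_generator2 r p m n L))"
      using hom by (simp add: homogeneous_quadrics_def)
    then show ?thesis unfolding shared_generator_swap by (elim disjE) simp_all
  qed
  have ob': "obstruction (swap_coeffs C) (swap_lattice p) m n = 0" for m n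
    by (simp add: obstruction_swap ob)
  obtain t where "\<forall>m n. t m n \<noteq> 0 \<and>
      moves (swap_coeffs C) (swap_lattice p) m n (t m n) (t m (n + 1)) \<and>
      conj_form (swap_coeffs C) (swap_lattice p) m n (t m n) (t (m + 1) n) = 0 \<and>
      swap_lattice p m n * t (m + 1) n \<noteq> t m n"
    using sw.parameters_exist[OF ob' hom2] by (rule exE)
  then have t: "\<And>m n. t m n \<noteq> 0"
    "\<And>m n. moves (swap_coeffs C) (swap_lattice p) m n (t m n) (t m (n + 1))"
    "\<And>m n. conj_form (swap_coeffs C) (swap_lattice p) m n (t m n) (t (m + 1) n) = 0"
    "\<And>m n. swap_lattice p m n * t (m + 1) n \<noteq> t m n"
    by simp_all
  \<comment> \<open>\<open>t\<close> is constructed on the mirrored net, hence the exchanged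
    arguments.\<close>
  define w where "w m n = lie_point r p m n (1, s m n) (1, t n m)" for m n
  have w': "swap_lattice w m n = lie_point (swap_lattice r) (swap_lattice p) m n (1, t m n) (1, swap_lattice s m n)"
    for m n unfolding lie_point_swap by (simp add: swap_lattice_def w_def)
  note e1 = edge_touches[of w s "\<lambda>m n. t n m", OF w_def t(1) s(3) t(2) s(4)]
  have "moves (swap_coeffs (swap_coeffs C)) (swap_lattice (swap_lattice p)) n m (swap_lattice s m n) (swap_lattice s (m + 1) n)"
    for m n by (simp add: swap_lattice_def s(2))
  note e2 = sw.edge_touches[of "swap_lattice w" t "swap_lattice s", OF w' _ t(3) this t(4),
      unfolded shared_generator_swap edge_swap tangent_plane_swap]
  have nz: "swap_lattice s m n \<noteq> 0" for m n using s(1) by (simp add: swap_lattice_def)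
  have "discrete_envelope r p w"
    unfolding discrete_envelope_def
  proof (intro allI conjI)
    fix m n
    show "w m n \<in> lie_quadric r p m n" by (auto simp: w_def lie_quadric_def)
    show "off_edges r m n (w m n)" unfolding w_def by (rule off_edges_lie_point) (rule s t)+
    show "dim (edge1 w m n) = 2" by (rule e1(1))
    show "dim (edge2 w m n) = 2" by (rule e2(1)[OF nz])
    show "edge1 w m n \<subseteq> tangent_plane r p m n (w m n)" by (rule e1(2))
    show "edge2 w m n \<subseteq> tangent_plane r p m n (w m n)"
      using e2(2)[OF nz, where m = n and n = m] by (simp add: swap_lattice_def)
    show "edge1 w (m - 1) n \<subseteq> tangent_plane r p m n (w m n)" using e1(3)[of "m - 1" n] by simp
    show "edge2 w m (n - 1) \<subseteq> tangent_plane r p m n (w m n)"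
      using e2(3)[OF nz, where m = "n - 1" and n = m] by (simp add: swap_lattice_def)
  qed
  moreover have "homogeneous_envelope r p w"
    unfolding homogeneous_envelope_def using e1(4) e2(4)[OF nz] by blast
  ultimately show ?thesis unfolding PMQ_wrt_def by blast
qed

text \<open>By homogeneity an envelope either has only shared generators as edges or has none among
  the edges of some direction; in the latter case the obstruction of that direction vanishes, and it
  is the same for both directions.\<close>

lemma PMQ_iff:
  assumes "homogeneous_quadrics r p"
  shows "PMQ_wrt r p \<longleftrightarrow> (\<forall>m n. obstruction C p m n = 0) \<or> Q_wrt r p"
proof
  assume "PMQ_wrt r p"
  then obtain w where env: "discrete_envelope r p w" and hom: "homogeneous_envelope r p w"
    unfolding PMQ_wrt_def by blast
  interpret sw: Lie_net "swap_lattice r" "swap_lattice p" "swap_coeffs C" by (rule swap_net)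
  consider "\<forall>m n. shared_generator1 r p m n (edge1 w m n) \<and> shared_generator2 r p m n (edge2 w m n)"
    | "\<forall>m n. \<not> shared_generator1 r p m n (edge1 w m n)"
    | "\<forall>m n. \<not> shared_generator2 r p m n (edge2 w m n)"
    using hom unfolding homogeneous_envelope_def by blast
  then show "(\<forall>m n. obstruction C p m n = 0) \<or> Q_wrt r p"
  proof cases
    case 1
    then show ?thesis using env unfolding Q_wrt_def by blast
  next
    case 2
    have "obstruction (swap_coeffs C) (swap_lattice p) n m = 0" for m n
      by (rule sw.obstruction_of_envelope[OF discrete_envelope_swap[OF env]])
        (simp add: shared_generator_swap edge_swap 2)
    then show ?thesis by (simp add: obstruction_swap)
  next
    case 3
    then show ?thesis using obstruction_of_envelope[OF env] by blast
  qed
next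
  assume "(\<forall>m n. obstruction C p m n = 0) \<or> Q_wrt r p"
  then show "PMQ_wrt r p"
    using PMQ_of_obstruction assms unfolding Q_wrt_def PMQ_wrt_def homogeneous_envelope_def by blast
qed

end

section \<open>Gauge transformations\<close>

definition gauge_coeffs :: "complex lattice_fun \<Rightarrow> real coeffs \<Rightarrow> complex coeffs" where
  "gauge_coeffs x C = \<lparr>
     al0 = \<lambda>m n. of_real (al0 C m n) * x (m + 2) n / x m n,
     al1 = \<lambda>m n. of_real (al1 C m n) * x (m + 2) n / x (m + 1) n,
     al3 = \<lambda>m n. of_real (al3 C m n) * x (m + 2) n / x (m + 1) (n + 1),
     be1 = \<lambda>m n. of_real (be1 C m n) * x (m + 2) (n + 1) / x (m + 1) n,
     be2 = \<lambda>m n. of_real (be2 C m n) * x (m + 2) (n + 1) / x m (n + 1),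
     be3 = \<lambda>m n. of_real (be3 C m n) * x (m + 2) (n + 1) / x (m + 1) (n + 1),
     ga0 = \<lambda>m n. of_real (ga0 C m n) * x m (n + 2) / x m n,
     ga2 = \<lambda>m n. of_real (ga2 C m n) * x m (n + 2) / x m (n + 1),
     ga3 = \<lambda>m n. of_real (ga3 C m n) * x m (n + 2) / x (m + 1) (n + 1),
     de1 = \<lambda>m n. of_real (de1 C m n) * x (m + 1) (n + 2) / x (m + 1) n,
     de2 = \<lambda>m n. of_real (de2 C m n) * x (m + 1) (n + 2) / x m (n + 1),
     de3 = \<lambda>m n. of_real (de3 C m n) * x (m + 1) (n + 2) / x (m + 1) (n + 1)\<rparr>"

lemma gauge_coeffs_swap: "gauge_coeffs (swap_lattice x) (swap_coeffs C) = swap_coeffs (gauge_coeffs x C)"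
  by (simp add: gauge_coeffs_def swap_coeffs_def swap_lattice_def fun_eq_iff)

lemma gauge_label_swap: "gauge_label (swap_lattice x) (swap_lattice p) = swap_lattice (gauge_label x p)"
  by (simp add: gauge_label_def swap_lattice_def fun_eq_iff mult.commute)

lemma T2_eq_T1_swap: "T2 C p m n = T1 (swap_coeffs C) (swap_lattice p) n m"
  by (simp add: T1_def T2_def D1_def D2_def swap_coeffs_sel swap_lattice_def mult_ac)

lemma normalised_gauge_swap:
  assumes "normalised_gauge C p" shows "normalised_gauge (swap_coeffs C) (swap_lattice p)"
  using assms unfolding normalised_gauge_def swap_coeffs_sel swap_lattice_def
  by (simp add: mult.commute)

lemma frame_equations_gauge:
  assumes r: "frame_equations r C" and x: "\<And>m n. x m n \<noteq> 0"
  shows "frame_equations (gauge_net x r) (gauge_coeffs x C)"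
  unfolding frame_equations_def
proof (intro allI)
  fix m n
  show "gauge_net x r (m + 2) n = al0 (gauge_coeffs x C) m n *s gauge_net x r m n
      + al1 (gauge_coeffs x C) m n *s gauge_net x r (m + 1) n
      + al3 (gauge_coeffs x C) m n *s gauge_net x r (m + 1) (n + 1) \<and>
    gauge_net x r (m + 2) (n + 1) = be1 (gauge_coeffs x C) m n *s gauge_net x r (m + 1) n
      + be2 (gauge_coeffs x C) m n *s gauge_net x r m (n + 1)
      + be3 (gauge_coeffs x C) m n *s gauge_net x r (m + 1) (n + 1) \<and>
    gauge_net x r m (n + 2) = ga0 (gauge_coeffs x C) m n *s gauge_net x r m n
      + ga2 (gauge_coeffs x C) m n *s gauge_net x r m (n + 1)
      + ga3 (gauge_coeffs x C) m n *s gauge_net x r (m + 1) (n + 1) \<and>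
    gauge_net x r (m + 1) (n + 2) = de1 (gauge_coeffs x C) m n *s gauge_net x r (m + 1) n
      + de2 (gauge_coeffs x C) m n *s gauge_net x r m (n + 1)
      + de3 (gauge_coeffs x C) m n *s gauge_net x r (m + 1) (n + 1)"
    using r[unfolded frame_equations_def, rule_format, of m n]
    by (simp add: vec_eq_iff gauge_net_def gauge_coeffs_def x algebra_simps)
qed

context labelled_frames
begin

lemma complex_frame_independent:
  fixes a b c d :: complex
  assumes "a *s (\<chi> i. of_real (r m n $ i)) + b *s (\<chi> i. of_real (r (m + 1) n $ i))
      + c *s (\<chi> i. of_real (r m (n + 1) $ i)) + d *s (\<chi> i. of_real (r (m + 1) (n + 1) $ i)) = 0"
  shows "a = 0 \<and> b = 0 \<and> c = 0 \<and> d = 0"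
proof -
  have eq: "a * of_real (r m n $ i) + b * of_real (r (m + 1) n $ i)
      + c * of_real (r m (n + 1) $ i) + d * of_real (r (m + 1) (n + 1) $ i) = 0" for i
    using assms by (simp add: vec_eq_iff)
  have "frame_point r m n (Re d) (Re b) (Re c) (Re a) = 0"
    using arg_cong[OF eq, of Re] by (simp add: frame_point_def vec_eq_iff algebra_simps)
  moreover have "frame_point r m n (Im d) (Im b) (Im c) (Im a) = 0"
    using arg_cong[OF eq, of Im] by (simp add: frame_point_def vec_eq_iff algebra_simps)
  ultimately show ?thesis by (simp add: frame_point_eq_0_iff complex_eq_iff)
qed

lemma gauge_frame_unique:
  assumes x: "\<And>m n. x m n \<noteq> 0"
    and eq: "a *s gauge_net x r m n + b *s gauge_net x r (m + 1) n
      + c *s gauge_net x r m (n + 1) + d *s gauge_net x r (m + 1) (n + 1)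
     = a' *s gauge_net x r m n + b' *s gauge_net x r (m + 1) n
      + c' *s gauge_net x r m (n + 1) + d' *s gauge_net x r (m + 1) (n + 1)"
  shows "a = a' \<and> b = b' \<and> c = c' \<and> d = d'"
proof -
  have "((a - a') * x m n) *s (\<chi> i. of_real (r m n $ i)) + ((b - b') * x (m + 1) n) *s (\<chi> i. of_real (r (m + 1) n $ i))
      + ((c - c') * x m (n + 1)) *s (\<chi> i. of_real (r m (n + 1) $ i))
      + ((d - d') * x (m + 1) (n + 1)) *s (\<chi> i. of_real (r (m + 1) (n + 1) $ i)) = 0"
    using eq by (simp add: gauge_net_def vec_eq_iff algebra_simps)
  from complex_frame_independent[OF this] show ?thesis using x by simp
qed

text \<open>The frames stay independent over the complex numbers, so the coefficients quantified in
  \<open>projective_minimal_wrt\<close> can only be the gauged ones.\<close>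

lemma gauge_coeffs_unique:
  assumes x: "\<And>m n. x m n \<noteq> 0"
    and 1: "frame_equations (gauge_net x r) C1" and 2: "frame_equations (gauge_net x r) C2"
  shows "C1 = C2"
proof -
  let ?r = "gauge_net x r"
  have "al0 C1 m n = al0 C2 m n \<and> al1 C1 m n = al1 C2 m n \<and> al3 C1 m n = al3 C2 m n \<and>
    be1 C1 m n = be1 C2 m n \<and> be2 C1 m n = be2 C2 m n \<and> be3 C1 m n = be3 C2 m n \<and>
    ga0 C1 m n = ga0 C2 m n \<and> ga2 C1 m n = ga2 C2 m n \<and> ga3 C1 m n = ga3 C2 m n \<and>
    de1 C1 m n = de1 C2 m n \<and> de2 C1 m n = de2 C2 m n \<and> de3 C1 m n = de3 C2 m n" for m n
  proof -
    note e1 = 1[unfolded frame_equations_def, rule_format, of m n]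
      and e2 = 2[unfolded frame_equations_def, rule_format, of m n]
    have "al0 C1 m n *s ?r m n + al1 C1 m n *s ?r (m + 1) n + 0 *s ?r m (n + 1) + al3 C1 m n *s ?r (m + 1) (n + 1)
        = al0 C2 m n *s ?r m n + al1 C2 m n *s ?r (m + 1) n + 0 *s ?r m (n + 1) + al3 C2 m n *s ?r (m + 1) (n + 1)"
      using e1 e2 by simp
    note a = gauge_frame_unique[OF x this]
    have "0 *s ?r m n + be1 C1 m n *s ?r (m + 1) n + be2 C1 m n *s ?r m (n + 1) + be3 C1 m n *s ?r (m + 1) (n + 1)
        = 0 *s ?r m n + be1 C2 m n *s ?r (m + 1) n + be2 C2 m n *s ?r m (n + 1) + be3 C2 m n *s ?r (m + 1) (n + 1)"
      using e1 e2 by simp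
    note b = gauge_frame_unique[OF x this]
    have "ga0 C1 m n *s ?r m n + 0 *s ?r (m + 1) n + ga2 C1 m n *s ?r m (n + 1) + ga3 C1 m n *s ?r (m + 1) (n + 1)
        = ga0 C2 m n *s ?r m n + 0 *s ?r (m + 1) n + ga2 C2 m n *s ?r m (n + 1) + ga3 C2 m n *s ?r (m + 1) (n + 1)"
      using e1 e2 by simp
    note g = gauge_frame_unique[OF x this]
    have "0 *s ?r m n + de1 C1 m n *s ?r (m + 1) n + de2 C1 m n *s ?r m (n + 1) + de3 C1 m n *s ?r (m + 1) (n + 1)
        = 0 *s ?r m n + de1 C2 m n *s ?r (m + 1) n + de2 C2 m n *s ?r m (n + 1) + de3 C2 m n *s ?r (m + 1) (n + 1)"
      using e1 e2 by simp
    note d = gauge_frame_unique[OF x this]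
    show ?thesis using a b g d by blast
  qed
  then show ?thesis by (intro coeffs.equality ext) simp_all
qed

end

text \<open>The quotient \<open>h\<close> of consecutive values in the first direction must satisfy
  \<open>h m (n + 1) = h m n * \<rho> m n\<close>. Two one-dimensional recursions solve this, one
  for \<open>h\<close> and one for \<open>x\<close>.\<close>

lemma lattice_product_exists:
  fixes \<rho> :: "int \<Rightarrow> int \<Rightarrow> 'a::field"
  assumes "\<And>m n. \<rho> m n \<noteq> 0"
  obtains x where "\<And>m n. x m n \<noteq> 0"
    "\<And>m n. x m n * x (m + 1) (n + 1) = \<rho> m n * x (m + 1) n * x m (n + 1)"
proof -
  have "\<exists>h. h 0 = 1 \<and> (\<forall>n. h n \<noteq> 0 \<and> h (n + 1) = h n * \<rho> m n)" for m
  proof (rule int_chain)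
    show "\<exists>b. b \<noteq> 0 \<and> b = a * \<rho> m n" if "a \<noteq> 0" for n a using that assms by simp
    show "\<exists>a. a \<noteq> 0 \<and> b = a * \<rho> m n" if "b \<noteq> 0" for n b
      using that assms by (intro exI[of _ "b / \<rho> m n"]) simp
  qed simp
  then obtain h where h: "\<And>m n. h m n \<noteq> 0" "\<And>m n. h m (n + 1) = h m n * \<rho> m n" by metis
  have "\<exists>x. x 0 = (\<lambda>n. 1) \<and> (\<forall>m. (\<forall>n. x m n \<noteq> 0) \<and> (\<forall>n. x (m + 1) n = x m n * h m n))"
  proof (rule int_chain)
    show "\<exists>b. (\<forall>n. b n \<noteq> 0) \<and> (\<forall>n. b n = a n * h m n)" if "\<forall>n. a n \<noteq> 0" for m a
      using that h by (intro exI[of _ "\<lambda>n. a n * h m n"]) simp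
    show "\<exists>a. (\<forall>n. a n \<noteq> 0) \<and> (\<forall>n. b n = a n * h m n)" if "\<forall>n. b n \<noteq> 0" for m b
      using that h by (intro exI[of _ "\<lambda>n. b n / h m n"]) simp
  qed simp
  then obtain x where x: "\<And>m n. x m n \<noteq> 0" "\<And>m n. x (m + 1) n = x m n * h m n" by metis
  have "x m n * x (m + 1) (n + 1) = \<rho> m n * x (m + 1) n * x m (n + 1)" for m n
    by (simp add: x(2) h(2))
  with x(1) show ?thesis by (rule that)
qed

section \<open>Projective minimality in the normalised gauge\<close>

context Lie_net
begin

lemma T1_disc: "T1 C p m n = disc C p m n / (al0 C m n)\<^sup>2"
proof -
  have "D1 C p m n = (be2 C m n * p m n)\<^sup>2 * disc C p m n"
    unfolding D1_def disc_def conj_coeff_def al0_label by (simp add: power2_eq_square algebra_simps)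
  then show ?thesis using coeffs_nonzero[of m n] label_nonzero[of m n]
    by (simp add: T1_def power_mult_distrib)
qed

lemma T1_gauge:
  assumes x: "\<And>m n. x m n \<noteq> 0"
  shows "T1 (gauge_coeffs x C) (gauge_label x p) m n
    = of_real (disc C p m n / (al0 C m n)\<^sup>2) * (x m n / x (m + 1) n)\<^sup>2"
proof -
  let ?C = "gauge_coeffs x C" and ?p = "gauge_label x p"
  \<comment> \<open>\<open>X\<close> is the common scaling factor of the two products inside the
    square of \<open>D1\<close>. The other summand scales by its square, so \<open>D1\<close> as a
    whole does too.\<close>
  define X where "X = x (m + 2) n * x (m + 2) (n + 1) / (x m n * x (m + 1) (n + 1))"
  have X: "X \<noteq> 0" using x by (simp add: X_def)
  have 1: "al0 ?C m n * be3 ?C m n = X * of_real (al0 C m n * be3 C m n)"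
    using x by (simp add: gauge_coeffs_def X_def)
  have 2: "al1 ?C m n * be2 ?C m n * ?p m n = X * of_real (al1 C m n * be2 C m n * p m n)"
    using x by (simp add: gauge_coeffs_def gauge_label_def X_def field_simps)
  have 3: "al0 ?C m n * be2 ?C m n * ?p m n
      = X * of_real (al0 C m n * be2 C m n * p m n) * (x (m + 1) n / x m n)"
    using x by (simp add: gauge_coeffs_def gauge_label_def X_def field_simps)
  have 4: "al3 ?C m n * be1 ?C m n = X * of_real (al3 C m n * be1 C m n) * (x m n / x (m + 1) n)"
    using x by (simp add: gauge_coeffs_def X_def field_simps)
  have "al0 ?C m n * al3 ?C m n * be1 ?C m n * be2 ?C m n * ?p m n
      = (al0 ?C m n * be2 ?C m n * ?p m n) * (al3 ?C m n * be1 ?C m n)" by (simp add: mult_ac)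
  also have "\<dots> = X\<^sup>2 * of_real (al0 C m n * al3 C m n * be1 C m n * be2 C m n * p m n)"
    unfolding 3 4 using x by (simp add: power2_eq_square)
  finally have "D1 ?C ?p m n = X\<^sup>2 * of_real (D1 C p m n)"
    unfolding D1_def 1 2 by (simp add: power2_eq_square algebra_simps)
  then have "T1 ?C ?p m n = of_real (T1 C p m n) * (x m n / x (m + 1) n)\<^sup>2"
    unfolding T1_def 3 using X x by (simp add: power_mult_distrib power_divide)
  then show ?thesis unfolding T1_disc .
qed

lemma normalised_gauge_iff:
  assumes x: "\<And>m n. x m n \<noteq> 0"
  shows "normalised_gauge (gauge_coeffs x C) (gauge_label x p) \<longleftrightarrow>
    (\<forall>m n. (gauge_label x p m n)\<^sup>2 * of_real (be2 C m n) = of_real (al0 C m (n + 1)))"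
proof -
  have "(1 - (gauge_label x p m n)\<^sup>2) * (be2 (gauge_coeffs x C) m n * de1 (gauge_coeffs x C) m n
        / (be1 (gauge_coeffs x C) m n * de2 (gauge_coeffs x C) m n)) = 1 \<longleftrightarrow>
    (gauge_label x p m n)\<^sup>2 * of_real (be2 C m n) = of_real (al0 C m (n + 1))" for m n
  proof -
    define P where "P = (gauge_label x p m n)\<^sup>2"
    have K: "be2 (gauge_coeffs x C) m n * de1 (gauge_coeffs x C) m n
        / (be1 (gauge_coeffs x C) m n * de2 (gauge_coeffs x C) m n)
      = of_real (be2 C m n * de1 C m n) / of_real (be1 C m n * de2 C m n)"
      using x by (simp add: gauge_coeffs_def field_simps)
    \<comment> \<open>The determinant of \<open>cross_ratio\<close> again: it turns the cross-ratio
      normalisation into one prescribing only the square of the label.\<close>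
    have "al0 C m (n + 1) * de1 C m n = be2 C m n * de1 C m n - be1 C m n * de2 C m n"
      using be1_eq[of m n] be2_eq[of m n] by algebra
    then have d: "complex_of_real (al0 C m (n + 1)) * of_real (de1 C m n)
        = of_real (be2 C m n * de1 C m n) - of_real (be1 C m n * de2 C m n)"
      by (metis of_real_diff of_real_mult)
    have "(1 - P) * (of_real (be2 C m n * de1 C m n) / of_real (be1 C m n * de2 C m n)) = 1
      \<longleftrightarrow> (1 - P) * of_real (be2 C m n * de1 C m n) = of_real (be1 C m n * de2 C m n)"
      using coeffs_nonzero[of m n] by (simp add: divide_eq_1_iff)
    also have "\<dots> \<longleftrightarrow> P * of_real (be2 C m n) * of_real (de1 C m n)
        = of_real (al0 C m (n + 1)) * of_real (de1 C m n)"
      unfolding d by (auto simp: algebra_simps)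
    also have "\<dots> \<longleftrightarrow> P * of_real (be2 C m n) = of_real (al0 C m (n + 1))"
      using coeffs_nonzero(7)[of m n] by simp
    finally show ?thesis unfolding K P_def .
  qed
  then show ?thesis unfolding normalised_gauge_def by simp
qed

text \<open>The ratios \<open>y\<close> and \<open>y'\<close> of gauge values are linked by the
  gauged label, whose square is prescribed. Eliminating \<open>y'\<close> leaves the relation
  between neighbouring discriminants found in \<open>obstruction_disc\<close>.\<close>

lemma T1_const_iff:
  assumes x: "\<And>m n. x m n \<noteq> 0"
    and norm: "normalised_gauge (gauge_coeffs x C) (gauge_label x p)"
  shows "T1 (gauge_coeffs x C) (gauge_label x p) m (n + 1) - T1 (gauge_coeffs x C) (gauge_label x p) m n = 0
    \<longleftrightarrow> obstruction C p m n = 0"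
proof -
  define A B where "A = disc C p m n" and "B = disc C p m (n + 1)"
  define y where "y = x m n / x (m + 1) n"
  define y' where "y' = x m (n + 1) / x (m + 1) (n + 1)"
  have y: "y \<noteq> 0" using x by (simp add: y_def)
  have "gauge_label x p m n * y = y' * of_real (p m n)"
    using x by (simp add: gauge_label_def y_def y'_def field_simps)
  then have "(gauge_label x p m n)\<^sup>2 * y\<^sup>2 = y'\<^sup>2 * (of_real (p m n))\<^sup>2" by (metis power_mult_distrib)
  then have y': "y'\<^sup>2 * of_real ((p m n)\<^sup>2 * be2 C m n) = of_real (al0 C m (n + 1)) * y\<^sup>2"
    using norm[unfolded normalised_gauge_iff[OF x], rule_format, of m n]
    by (simp add: mult.assoc[symmetric]) (metis mult.assoc mult.commute)
  have nz: "(p m n)\<^sup>2 * be2 C m n \<noteq> 0" using coeffs_nonzero label_nonzero by simp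
  have "T1 (gauge_coeffs x C) (gauge_label x p) m (n + 1) - T1 (gauge_coeffs x C) (gauge_label x p) m n = 0
    \<longleftrightarrow> of_real (B / (al0 C m (n + 1))\<^sup>2) * y'\<^sup>2 = of_real (A / (al0 C m n)\<^sup>2) * y\<^sup>2"
    unfolding T1_gauge[OF x] A_def B_def y_def y'_def by simp
  also have "\<dots> \<longleftrightarrow> of_real (B / (al0 C m (n + 1))\<^sup>2) * y'\<^sup>2 * of_real ((p m n)\<^sup>2 * be2 C m n)
      = of_real (A / (al0 C m n)\<^sup>2) * y\<^sup>2 * of_real ((p m n)\<^sup>2 * be2 C m n)"
    using nz by (metis mult_right_cancel of_real_eq_0_iff)
  also have "\<dots> \<longleftrightarrow> of_real (B / (al0 C m (n + 1))\<^sup>2 * al0 C m (n + 1)) * y\<^sup>2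
      = of_real (A / (al0 C m n)\<^sup>2 * ((p m n)\<^sup>2 * be2 C m n)) * y\<^sup>2"
    unfolding of_real_mult[of "B / _"] of_real_mult[of "A / _"] mult.assoc y' by (simp add: mult_ac)
  also have "\<dots> \<longleftrightarrow> complex_of_real (B / (al0 C m (n + 1))\<^sup>2 * al0 C m (n + 1))
      = of_real (A / (al0 C m n)\<^sup>2 * ((p m n)\<^sup>2 * be2 C m n))"
    by (rule mult_right_cancel) (simp add: y)
  also have "\<dots> \<longleftrightarrow> B / al0 C m (n + 1) = A / ((p (m + 1) n)\<^sup>2 * be2 C m n)"
    unfolding of_real_eq_iff using label_nonzero coeffs_nonzero al0_label[of m n]
    by (simp add: power2_eq_square mult.assoc)
  also have "\<dots> \<longleftrightarrow> (p (m + 1) n)\<^sup>2 * be2 C m n * B - al0 C m (n + 1) * A = 0"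
    using label_nonzero coeffs_nonzero by (auto simp: field_simps)
  also have "\<dots> \<longleftrightarrow> obstruction C p m n = 0"
    using obstruction_disc[of m n] coeffs_nonzero label_nonzero
    by (metis A_def B_def mult_eq_0_iff neg_equal_0_iff_equal)
  finally show ?thesis .
qed

lemma normalised_gauge_exists:
  obtains x where "\<And>m n. x m n \<noteq> 0" "normalised_gauge (gauge_coeffs x C) (gauge_label x p)"
proof -
  \<comment> \<open>\<open>P\<close> is the prescribed new label; the gauge function is then found
    by solving for the quotient of \<open>p\<close> and \<open>P\<close>.\<close>
  define P where "P m n = csqrt (of_real (al0 C m (n + 1) / be2 C m n))" for m n
  have P0: "P m n \<noteq> 0" for m n using coeffs_nonzero by (simp add: P_def)
  obtain x where x: "\<And>m n. x m n \<noteq> 0"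
    "\<And>m n. x m n * x (m + 1) (n + 1) = of_real (p m n) / P m n * x (m + 1) n * x m (n + 1)"
    using lattice_product_exists[of "\<lambda>m n. of_real (p m n) / P m n"] P0 label_nonzero by auto
  have "gauge_label x p m n = P m n" for m n
    using x P0 label_nonzero by (simp add: gauge_label_def)
  then have "(gauge_label x p m n)\<^sup>2 * of_real (be2 C m n) = of_real (al0 C m (n + 1))" for m n
    using coeffs_nonzero by (simp add: P_def)
  then have "normalised_gauge (gauge_coeffs x C) (gauge_label x p)"
    by (simp add: normalised_gauge_iff[of x, OF x(1)])
  with x(1) show ?thesis by (rule that)
qed

text \<open>The criterion with \<open>T2\<close> is the one with \<open>T1\<close> on the mirrored
  net, and the symmetry of the obstruction makes both alternatives mean the same.\<close>

lemma projective_minimal_iff: "projective_minimal_wrt r p \<longleftrightarrow> (\<forall>m n. obstruction C p m n = 0)"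
proof
  assume "projective_minimal_wrt r p"
  then obtain x C' where x: "\<And>m n. x m n \<noteq> 0" and C': "frame_equations (gauge_net x r) C'"
    and norm: "normalised_gauge C' (gauge_label x p)"
    and T: "(\<forall>m n. T1 C' (gauge_label x p) m (n + 1) - T1 C' (gauge_label x p) m n = 0) \<or>
       (\<forall>m n. T2 C' (gauge_label x p) (m + 1) n - T2 C' (gauge_label x p) m n = 0)"
    unfolding projective_minimal_wrt_def by blast
  have eq: "C' = gauge_coeffs x C"
    by (rule gauge_coeffs_unique[OF x C' frame_equations_gauge[OF frame_eqs x]])
  interpret sw: Lie_net "swap_lattice r" "swap_lattice p" "swap_coeffs C" by (rule swap_net)
  have x': "swap_lattice x m n \<noteq> 0" for m n using x by (simp add: swap_lattice_def)
  have norm': "normalised_gauge (gauge_coeffs (swap_lattice x) (swap_coeffs C))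
      (gauge_label (swap_lattice x) (swap_lattice p))"
    unfolding gauge_coeffs_swap gauge_label_swap using norm[unfolded eq] by (rule normalised_gauge_swap)
  show "\<forall>m n. obstruction C p m n = 0" using T
  proof
    assume "\<forall>m n. T1 C' (gauge_label x p) m (n + 1) - T1 C' (gauge_label x p) m n = 0"
    then show ?thesis using T1_const_iff[OF x norm[unfolded eq]] unfolding eq by blast
  next
    assume "\<forall>m n. T2 C' (gauge_label x p) (m + 1) n - T2 C' (gauge_label x p) m n = 0"
    then have "obstruction (swap_coeffs C) (swap_lattice p) n m = 0" for m n
      using sw.T1_const_iff[OF x' norm', of n m]
      unfolding eq T2_eq_T1_swap gauge_coeffs_swap gauge_label_swap by blast
    then show ?thesis by (simp add: obstruction_swap)
  qed
next
  assume ob: "\<forall>m n. obstruction C p m n = 0"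
  obtain x where x: "\<And>m n. x m n \<noteq> 0" and norm: "normalised_gauge (gauge_coeffs x C) (gauge_label x p)"
    using normalised_gauge_exists by blast
  have "frame_equations (gauge_net x r) (gauge_coeffs x C)"
    by (rule frame_equations_gauge[OF frame_eqs x])
  moreover have "\<forall>m n. T1 (gauge_coeffs x C) (gauge_label x p) m (n + 1) - T1 (gauge_coeffs x C) (gauge_label x p) m n = 0"
    using T1_const_iff[OF x norm] ob by blast
  ultimately show "projective_minimal_wrt r p"
    unfolding projective_minimal_wrt_def using x norm by blast
qed

end

lemma net_with_quadrics_Lie_net:
  assumes "net_with_quadrics r p"
  obtains C where "Lie_net r p C"
proof -
  obtain C where "frame_equations r C" "regular_coeffs C" "frames_independent r" "lattice_Lie_quadrics r p"
    using assms unfolding net_with_quadrics_def discrete_asymptotic_net_def by blast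
  moreover from this have "p m n \<noteq> 0" for m n by (simp add: lattice_Lie_quadrics_def)
  ultimately have "Lie_net r p C" by unfold_locales
  then show ?thesis by (rule that)
qed

theorem corollary7p5:
  shows "(\<forall>r p. net_with_quadrics r p \<longrightarrow>
            (PMQ_wrt r p \<longleftrightarrow> projective_minimal_wrt r p \<or> Q_wrt r p))
       \<and> {r. discrete_PMQ_surface r} =
           {r. discrete_projective_minimal_surface r} \<union> {r. discrete_Q_surface r}"
proof -
  have main: "PMQ_wrt r p \<longleftrightarrow> projective_minimal_wrt r p \<or> Q_wrt r p" if net: "net_with_quadrics r p" for r p
  proof -
    obtain C where "Lie_net r p C" using net_with_quadrics_Lie_net[OF net] .
    then interpret Lie_net r p C .
    have "homogeneous_quadrics r p" using net by (simp add: net_with_quadrics_def)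
    then show ?thesis unfolding projective_minimal_iff by (rule PMQ_iff)
  qed
  moreover have "discrete_PMQ_surface r \<longleftrightarrow> discrete_projective_minimal_surface r \<or> discrete_Q_surface r" for r
    unfolding discrete_PMQ_surface_def discrete_projective_minimal_surface_def discrete_Q_surface_def
    using main by blast
  ultimately show ?thesis by blast
qed

end
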